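(* Let $m_1,m_2,m_3>0$ be arbitrary. The set of balanced configurations in the triangle of shapes is always the union of three smooth curves, with three pairs of ends which are the three vertices $[1,0,0],[0,1,0],[0,0,1]$ of the triangle of shapes and the three points $[0,1,1],[1,0,1],[1,1,0]$ on its sides corresponding to two equal mutual distances and a zero mutual distance.
   Context: For three bodies with mutual distances $d_{ij}$ write $a=d_{23}^2$, $b=d_{13}^2$, $c=d_{12}^2$. The triangle of shapes is the set of triples $(a,b,c)$ with $a,b,c>0$ considered up to multiplication by a positive factor, written $[a,b,c]$; equivalently it is the intersection of the positive octant with the plane $I=\mathrm{const}$, where $I=(m_1m_2c+m_2m_3a+m_3m_1b)/(m_1+m_2+m_3)$. Its sides are $a=0$, $b=0$, $c=0$ and its vertices are $[1,0,0],[0,1,0],[0,0,1]$. The triangle inequality for the distances is not required. A point $[a,b,c]$ of the triangle of shapes is called a balanced configuration if $B=0$, where $$B=\det\begin{pmatrix}1&1&1\\ m_1(b+c-a)&m_2(c+a-b)&m_3(a+b-c)\\ a^{-3/2}&b^{-3/2}&c^{-3/2}\end{pmatrix}.$$ The three curves may intersect each other. *)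

theory Defs
  imports "HOL-Analysis.Analysis" "HOL-Library.Multiset"
begin

text \<open>
  A triple \<open>(a, b, c)\<close> is a vector \<open>p :: real^3\<close> with \<open>p$1 = a\<close>, \<open>p$2 = b\<close>, \<open>p$3 = c\<close>, the squared
  mutual distances \<open>d\<^sub>2\<^sub>3\<^sup>2\<close>, \<open>d\<^sub>1\<^sub>3\<^sup>2\<close>, \<open>d\<^sub>1\<^sub>2\<^sup>2\<close>; the masses are the components of \<open>m :: real^3\<close>.
\<close>

definition inertia :: "real^3 \<Rightarrow> real^3 \<Rightarrow> real" where
  "inertia m p = (m$1 * m$2 * p$3 + m$2 * m$3 * p$1 + m$3 * m$1 * p$2) / (m$1 + m$2 + m$3)"

text \<open>
  Triples up to a positive factor are represented by their unique positive multiple in the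
  plane \<open>inertia m p = \<kappa>\<close>, for a fixed \<open>\<kappa> > 0\<close>.
\<close>

definition shape_triangle :: "real^3 \<Rightarrow> real \<Rightarrow> (real^3) set" where
  "shape_triangle m \<kappa> = {p. p$1 > 0 \<and> p$2 > 0 \<and> p$3 > 0 \<and> inertia m p = \<kappa>}"

text \<open>The representative of \<open>[a, b, c]\<close>, also for points on the boundary of the triangle.\<close>

definition shape :: "real^3 \<Rightarrow> real \<Rightarrow> real \<Rightarrow> real \<Rightarrow> real \<Rightarrow> real^3" where
  "shape m \<kappa> a b c = (\<kappa> / inertia m (vector [a, b, c])) *\<^sub>R vector [a, b, c]"

definition balance_matrix :: "real^3 \<Rightarrow> real^3 \<Rightarrow> real^3^3" where
  "balance_matrix m p = (let a = p$1; b = p$2; c = p$3 in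
     vector [vector [1, 1, 1],
             vector [m$1 * (b + c - a), m$2 * (c + a - b), m$3 * (a + b - c)],
             vector [a powr (-3/2), b powr (-3/2), c powr (-3/2)]])"

text \<open>
  The determinant is homogeneous in \<open>p\<close>, so its vanishing does not depend on the representative.
\<close>

definition balanced_configurations :: "real^3 \<Rightarrow> real \<Rightarrow> (real^3) set" where
  "balanced_configurations m \<kappa> = {p \<in> shape_triangle m \<kappa>. det (balance_matrix m p) = 0}"

text \<open>Class \<open>C\<^sup>\<infinity>\<close> on an open set \<open>S\<close>: \<open>D n\<close> is the \<open>n\<close>-th derivative of \<open>f\<close> on \<open>S\<close>.\<close>

definition C_infinity_on :: "real set \<Rightarrow> (real \<Rightarrow> 'a::real_normed_vector) \<Rightarrow> bool" where
  "C_infinity_on S f \<longleftrightarrow>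
     (\<exists>D :: nat \<Rightarrow> real \<Rightarrow> 'a. D 0 = f \<and>
        (\<forall>n. \<forall>t\<in>S. (D n has_vector_derivative D (Suc n) t) (at t)))"

text \<open>
  A smooth curve without self-intersection, parametrised by the open interval \<open>(0, 1)\<close> with
  nowhere vanishing velocity. Its ends \<open>P\<close> and \<open>Q\<close> are limits only: they need not
  lie on the curve, and no smoothness is required there.
\<close>

definition smooth_curve_with_ends :: "(real \<Rightarrow> real^3) \<Rightarrow> real^3 \<Rightarrow> real^3 \<Rightarrow> bool" where
  "smooth_curve_with_ends \<gamma> P Q \<longleftrightarrow>
     C_infinity_on {0<..<1} \<gamma> \<and>
     inj_on \<gamma> {0<..<1} \<and>
     (\<forall>t\<in>{0<..<1}. vector_derivative \<gamma> (at t) \<noteq> 0) \<and>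
     (\<gamma> \<longlongrightarrow> P) (at_right 0) \<and>
     (\<gamma> \<longlongrightarrow> Q) (at_left 1)"

end

theory Submission
  imports Defs
begin

text \<open>
  Multiplied by the cube of the product of the distances, the determinant becomes a homogeneous
  polynomial of degree 8 in the three distances (\<open>balance_poly\<close>). With the third distance set to 1
  and the other two called \<open>w\<close> and \<open>z\<close>, it is for every fixed \<open>w\<close> a quintic
  \<open>L z^5 + K z^3 + P z^2 + Q\<close>. The gaps in its exponents are what makes it tractable: divided by
  \<open>z^2\<close> it becomes \<open>L z^3 + K z + P + Q / z^2\<close>, which is convex on \<open>z > 0\<close> if \<open>L \<ge> 0\<close> and \<open>Q > 0\<close>, and
  concave if both signs are reversed. So it has at most two roots, one where it decreases and one
  where it increases, and they are simple and separated by \<open>z = 1\<close> as soon as the quintic has there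
  the sign opposite to that of \<open>Q\<close> (\<open>quintic_above_tangent\<close>). The decreasing roots therefore form a
  graph over the set of \<open>w\<close> for which they exist, and so do the increasing ones. By the implicit
  function theorem these graphs are smooth (\<open>smooth_quintic_branch\<close>), and the signs of the polynomial
  near the sides of the triangle locate their ends.

  Up to a permutation of the bodies, there are three types of masses.

  If \<open>m\<^sub>1 \<ge> m\<^sub>2 > m\<^sub>3\<close>, the decreasing root exists for all \<open>w > 0\<close> and runs from \<open>[0,0,1]\<close> to \<open>[1,1,0]\<close>.
  The increasing root exists for \<open>w > 1\<close>, where it runs from \<open>[1,0,1]\<close> to \<open>[1,0,0]\<close>, and for \<open>w < r\<close>
  with a number \<open>r < 1\<close> at which \<open>L\<close> vanishes and the root escapes to infinity; there it runs from
  \<open>[0,1,1]\<close> to \<open>[0,1,0]\<close>. Between \<open>r\<close> and 1, where \<open>L \<le> 0 < Q\<close>, the quintic divided by \<open>z^3\<close> is decreasing,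
  so that no other root exists there.

  If \<open>m\<^sub>1 = m\<^sub>3 < m\<^sub>2\<close>, the polynomial has the factor \<open>1 - w\<close>, which gives the line \<open>a = c\<close>. The cofactor
  is a quintic of the convex type for all \<open>w > 0\<close>, with one decreasing and one increasing root. Both of
  their curves cross the line \<open>a = c\<close>. The zero set is singular at the crossings, but each curve is
  smooth there, since the roots of the cofactor are simple.

  If the masses are equal, the polynomial is \<open>(1 - w) (z - 1) (z - w)\<close> times a positive factor, and
  the curves are the three lines of isosceles shapes.
\<close>

section \<open>Smooth functions of one variable\<close>

text \<open>
  A finite order of differentiability is needed because the smoothness of an implicit function is
  proved by induction on the order: its derivative is an expression in the function itself.
\<close>

primrec smooth_upto :: "nat \<Rightarrow> real set \<Rightarrow> (real \<Rightarrow> real) \<Rightarrow> bool" where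
  "smooth_upto 0 S f = True"
| "smooth_upto (Suc n) S f =
     (\<exists>f'. (\<forall>x\<in>S. (f has_real_derivative f' x) (at x)) \<and> smooth_upto n S f')"

lemma smooth_upto_cong:
  assumes "open S" "\<And>x. x \<in> S \<Longrightarrow> f x = g x" "smooth_upto n S f"
  shows "smooth_upto n S g"
proof (cases n)
  case (Suc k)
  then obtain f' where f': "\<forall>x\<in>S. (f has_real_derivative f' x) (at x)" "smooth_upto k S f'"
    using assms(3) by auto
  have "(g has_real_derivative f' x) (at x)" if "x \<in> S" for x
    using has_field_derivative_transform_within_open[of f "f' x" x S g] f'(1) assms(1,2) that by auto
  then show ?thesis using Suc f'(2) by auto
qed simp

lemma smooth_upto_Suc_imp: "smooth_upto (Suc n) S f \<Longrightarrow> smooth_upto n S f"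
proof (induction n arbitrary: f)
  case (Suc n)
  then obtain f' where "\<forall>x\<in>S. (f has_real_derivative f' x) (at x)" "smooth_upto (Suc n) S f'"
    by (subst (asm) (3) smooth_upto.simps(2)) blast
  then show ?case using Suc.IH[of f'] by auto
qed simp

lemma smooth_upto_const: "smooth_upto n S (\<lambda>_. c)"
proof (induction n arbitrary: c)
  case (Suc n)
  have "\<forall>x\<in>S. ((\<lambda>_. c) has_real_derivative 0) (at x)" by auto
  then show ?case using Suc[of 0] by (auto intro!: exI[of _ "\<lambda>_. 0"])
qed simp

lemma smooth_upto_ident: "smooth_upto n S (\<lambda>x. x)"
  by (cases n) (auto intro!: exI[of _ "\<lambda>_. 1"] smooth_upto_const)

lemma smooth_upto_add:
  "smooth_upto n S f \<Longrightarrow> smooth_upto n S g \<Longrightarrow> smooth_upto n S (\<lambda>x. f x + g x)"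
proof (induction n arbitrary: f g)
  case (Suc n)
  then obtain f' g' where *: "\<forall>x\<in>S. (f has_real_derivative f' x) (at x)" "smooth_upto n S f'"
    "\<forall>x\<in>S. (g has_real_derivative g' x) (at x)" "smooth_upto n S g'" by auto
  then have "\<forall>x\<in>S. ((\<lambda>x. f x + g x) has_real_derivative f' x + g' x) (at x)"
    by (auto intro!: derivative_intros)
  then show ?case using Suc.IH[OF *(2,4)] by auto
qed simp

lemma smooth_upto_mult:
  "smooth_upto n S f \<Longrightarrow> smooth_upto n S g \<Longrightarrow> smooth_upto n S (\<lambda>x. f x * g x)"
proof (induction n arbitrary: f g)
  case (Suc n)
  then obtain f' g' where *: "\<forall>x\<in>S. (f has_real_derivative f' x) (at x)" "smooth_upto n S f'"
    "\<forall>x\<in>S. (g has_real_derivative g' x) (at x)" "smooth_upto n S g'" by auto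
  then have "\<forall>x\<in>S. ((\<lambda>x. f x * g x) has_real_derivative f' x * g x + g' x * f x) (at x)"
    by (auto intro!: DERIV_mult)
  moreover have "smooth_upto n S (\<lambda>x. f' x * g x + g' x * f x)"
    using Suc.prems[THEN smooth_upto_Suc_imp] *(2,4) by (intro smooth_upto_add Suc.IH)
  ultimately show ?case by auto
qed simp

lemma smooth_upto_power: "smooth_upto n S f \<Longrightarrow> smooth_upto n S (\<lambda>x. f x ^ k)"
  by (induction k) (simp_all add: smooth_upto_const smooth_upto_mult)

lemma smooth_upto_inverse:
  assumes "\<And>x. x \<in> S \<Longrightarrow> f x \<noteq> 0"
  shows "smooth_upto n S f \<Longrightarrow> smooth_upto n S (\<lambda>x. inverse (f x))"
proof (induction n)
  case (Suc n)
  then obtain f' where *: "\<forall>x\<in>S. (f has_real_derivative f' x) (at x)" "smooth_upto n S f'"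
    by auto
  then have "\<forall>x\<in>S. ((\<lambda>x. inverse (f x)) has_real_derivative
      (-1) * (inverse (f x) * (f' x * inverse (f x)))) (at x)"
    using assms by (auto intro!: derivative_eq_intros)
  moreover have "smooth_upto n S (\<lambda>x. (-1) * (inverse (f x) * (f' x * inverse (f x))))"
    using Suc.IH[OF smooth_upto_Suc_imp[OF Suc.prems]] *(2)
    by (intro smooth_upto_mult smooth_upto_const)
  ultimately show ?case by auto
qed simp

lemma smooth_upto_compose:
  assumes "\<And>x. x \<in> S \<Longrightarrow> h x \<in> T"
  shows "smooth_upto n T f \<Longrightarrow> smooth_upto n S h \<Longrightarrow> smooth_upto n S (\<lambda>x. f (h x))"
proof (induction n arbitrary: f)
  case (Suc n)
  then obtain f' h' where *: "\<forall>x\<in>T. (f has_real_derivative f' x) (at x)" "smooth_upto n T f'"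
    "\<forall>x\<in>S. (h has_real_derivative h' x) (at x)" "smooth_upto n S h'" by auto
  then have "\<forall>x\<in>S. ((\<lambda>x. f (h x)) has_real_derivative f' (h x) * h' x) (at x)"
    using assms DERIV_chain2[of f _ h _ _ UNIV] by blast
  moreover have "smooth_upto n S (\<lambda>x. f' (h x) * h' x)"
    using Suc.IH[OF *(2) smooth_upto_Suc_imp[OF Suc.prems(2)]] *(4) by (rule smooth_upto_mult)
  ultimately show ?case by auto
qed simp

text \<open>
  Derivatives on an open set are unique, so the derivatives that exist up to every finite order fit
  together into one sequence, that of the iterated \<open>deriv\<close>.
\<close>

lemma C_infinity_on_iff_smooth_upto:
  fixes f :: "real \<Rightarrow> real"
  assumes "open S"
  shows "C_infinity_on S f \<longleftrightarrow> (\<forall>n. smooth_upto n S f)"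
proof
  assume "C_infinity_on S f"
  then obtain D where D: "D 0 = f"
    "\<And>n t. t \<in> S \<Longrightarrow> (D n has_vector_derivative D (Suc n) t) (at t)"
    unfolding C_infinity_on_def by auto
  have "smooth_upto n S (D k)" for n k
  proof (induction n arbitrary: k)
    case (Suc n)
    then show ?case using D(2) by (auto simp: has_real_derivative_iff_has_vector_derivative)
  qed simp
  then show "\<forall>n. smooth_upto n S f" using D(1) by metis
next
  assume *: "\<forall>n. smooth_upto n S f"
  have deriv: "smooth_upto n S (deriv h)" if "smooth_upto (Suc n) S h" for n h
  proof -
    from that obtain h' where h': "\<forall>x\<in>S. (h has_real_derivative h' x) (at x)" "smooth_upto n S h'"
      by auto
    have "h' x = deriv h x" if "x \<in> S" for x
      using DERIV_imp_deriv[OF bspec[OF h'(1) that]] by simp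
    then show ?thesis using smooth_upto_cong[OF assms _ h'(2)] by blast
  qed
  have all: "smooth_upto k S ((deriv ^^ n) f)" for k n
  proof (induction n arbitrary: k)
    case (Suc n)
    show ?case using deriv[OF Suc[of "Suc k"]] by simp
  qed (use * in simp)
  have "((deriv ^^ n) f has_vector_derivative (deriv ^^ Suc n) f t) (at t)" if "t \<in> S" for n t
  proof -
    obtain h' where "\<forall>x\<in>S. ((deriv ^^ n) f has_real_derivative h' x) (at x)"
      using all[of "Suc 0" n] by auto
    then have h': "((deriv ^^ n) f has_real_derivative h' t) (at t)"
      using that by blast
    then show ?thesis
      using DERIV_imp_deriv[OF h'] by (simp add: has_real_derivative_iff_has_vector_derivative)
  qed
  then show "C_infinity_on S f"
    unfolding C_infinity_on_def by (intro exI[of _ "\<lambda>n. (deriv ^^ n) f"]) auto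
qed

context
  fixes S :: "real set"
  assumes S: "open S"
begin

lemma C_infinity_on_const: "C_infinity_on S (\<lambda>_. c :: real)"
  and C_infinity_on_ident: "C_infinity_on S (\<lambda>x. x)"
  using S by (simp_all add: C_infinity_on_iff_smooth_upto smooth_upto_const smooth_upto_ident)

lemma C_infinity_on_add:
  "C_infinity_on S f \<Longrightarrow> C_infinity_on S g \<Longrightarrow> C_infinity_on S (\<lambda>x. f x + g x :: real)"
  and C_infinity_on_mult:
  "C_infinity_on S f \<Longrightarrow> C_infinity_on S g \<Longrightarrow> C_infinity_on S (\<lambda>x. f x * g x :: real)"
  using S by (simp_all add: C_infinity_on_iff_smooth_upto smooth_upto_add smooth_upto_mult)

lemma C_infinity_on_diff:
  "C_infinity_on S f \<Longrightarrow> C_infinity_on S g \<Longrightarrow> C_infinity_on S (\<lambda>x. f x - g x :: real)"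
  using C_infinity_on_add[of f "\<lambda>x. (-1) * g x"] C_infinity_on_mult[of "\<lambda>_. -1" g]
    C_infinity_on_const[of "-1"] by simp

lemma C_infinity_on_power:
  "C_infinity_on S f \<Longrightarrow> C_infinity_on S (\<lambda>x. f x ^ k :: real)"
  by (induction k) (simp_all add: C_infinity_on_const C_infinity_on_mult)

lemma C_infinity_on_divide:
  assumes "C_infinity_on S f" "C_infinity_on S g" "\<And>x. x \<in> S \<Longrightarrow> g x \<noteq> 0"
  shows "C_infinity_on S (\<lambda>x. f x / g x :: real)"
  using assms S
  by (simp add: C_infinity_on_iff_smooth_upto divide_inverse smooth_upto_mult smooth_upto_inverse)

lemmas C_infinity_intros = C_infinity_on_const C_infinity_on_ident C_infinity_on_add
  C_infinity_on_mult C_infinity_on_diff C_infinity_on_power C_infinity_on_divide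

end

lemma C_infinity_on_compose:
  fixes f :: "real \<Rightarrow> real"
  assumes "open S" "open T" "C_infinity_on T f" "C_infinity_on S h" "\<And>x. x \<in> S \<Longrightarrow> h x \<in> T"
  shows "C_infinity_on S (\<lambda>x. f (h x))"
  using assms smooth_upto_compose[of S h T] by (simp add: C_infinity_on_iff_smooth_upto)

lemma C_infinity_on_derivative:
  fixes f :: "real \<Rightarrow> real"
  assumes "C_infinity_on S f"
  obtains f' where "C_infinity_on S f'" "\<And>w. w \<in> S \<Longrightarrow> (f has_real_derivative f' w) (at w)"
proof -
  obtain D where D: "D 0 = f" "\<forall>n. \<forall>t\<in>S. (D n has_vector_derivative D (Suc n) t) (at t)"
    using assms unfolding C_infinity_on_def by auto
  have "C_infinity_on S (D 1)"
    unfolding C_infinity_on_def using D(2) by (intro exI[of _ "\<lambda>n. D (Suc n)"]) auto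
  moreover have "(f has_real_derivative D 1 w) (at w)" if "w \<in> S" for w
    using D(1) D(2)[rule_format, OF that, of 0]
    by (simp add: has_real_derivative_iff_has_vector_derivative)
  ultimately show thesis using that by blast
qed

lemma C_infinity_on_vec:
  fixes f :: "real \<Rightarrow> real ^ 'n"
  assumes "\<And>i. C_infinity_on S (\<lambda>t. f t $ i)"
  shows "C_infinity_on S f"
proof -
  have "\<forall>i. \<exists>D. D 0 = (\<lambda>t. f t $ i) \<and>
      (\<forall>n. \<forall>t\<in>S. (D n has_vector_derivative D (Suc n) t) (at t))"
    using assms unfolding C_infinity_on_def by blast
  from choice[OF this] obtain D where D: "\<And>i. D i 0 = (\<lambda>t. f t $ i)"
    "\<And>i n t. t \<in> S \<Longrightarrow> (D i n has_vector_derivative D i (Suc n) t) (at t)"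
    by blast
  have sum: "(\<Sum>i\<in>UNIV. x i *\<^sub>R axis i 1) = (\<chi> i. x i)" for x :: "'n \<Rightarrow> real"
    using basis_expansion[of "\<chi> i. x i"] by (simp add: scalar_mult_eq_scaleR)
  have "((\<lambda>t. \<Sum>i\<in>UNIV. D i n t *\<^sub>R axis i 1) has_vector_derivative
      (\<Sum>i\<in>UNIV. D i (Suc n) t *\<^sub>R axis i (1::real))) (at t)" if "t \<in> S" for n t
  proof (rule has_vector_derivative_sum)
    fix i
    show "((\<lambda>t. D i n t *\<^sub>R axis i 1) has_vector_derivative D i (Suc n) t *\<^sub>R axis i (1::real)) (at t)"
      using bounded_linear.has_vector_derivative[OF bounded_linear_scaleR_left D(2)[OF that]] .
  qed
  then have "((\<lambda>t. \<chi> i. D i n t) has_vector_derivative (\<chi> i. D i (Suc n) t)) (at t)"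
    if "t \<in> S" for n t using that by (simp only: sum)
  moreover have "(\<lambda>t. \<chi> i. D i 0 t) = f" by (auto simp: D(1) vec_eq_iff)
  ultimately show ?thesis
    unfolding C_infinity_on_def by (intro exI[of _ "\<lambda>n t. \<chi> i. D i n t"]) auto
qed

section \<open>Smoothness of implicitly defined functions\<close>

text \<open>
  A neighbourhood of product form, in which the two variables can be moved independently.
\<close>

lemma isCont_pos_box:
  fixes f :: "real \<times> real \<Rightarrow> real"
  assumes "isCont f (a, b)" "f (a, b) > 0"
  obtains d where "d > 0" "\<And>x y. \<bar>x - a\<bar> < d \<Longrightarrow> \<bar>y - b\<bar> < d \<Longrightarrow> f (x, y) > 0"
proof -
  have "\<forall>\<^sub>F p in nhds (a, b). f p > 0"
    using assms by (auto simp: isCont_def tendsto_at_iff_tendsto_nhds dest: order_tendstoD(1))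
  then obtain P Q where PQ: "eventually P (nhds a)" "eventually Q (nhds b)"
    "\<And>x y. P x \<Longrightarrow> Q y \<Longrightarrow> f (x, y) > 0"
    unfolding nhds_prod eventually_prod_filter by auto
  from PQ(1,2) obtain d1 d2 where "d1 > 0" "\<And>x. \<bar>x - a\<bar> < d1 \<Longrightarrow> P x"
    "d2 > 0" "\<And>y. \<bar>y - b\<bar> < d2 \<Longrightarrow> Q y"
    unfolding eventually_nhds_metric dist_real_def by auto
  then show thesis using PQ(3) by (intro that[of "min d1 d2"]) auto
qed

lemma root_between:
  fixes f :: "real \<Rightarrow> real"
  assumes "u < v" "continuous_on {u..v} f" "f u * f v < 0"
  shows "\<exists>z. u < z \<and> z < v \<and> f z = 0"
proof -
  have "\<exists>z. u \<le> z \<and> z \<le> v \<and> f z = 0"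
  proof (cases "f u < 0")
    case True
    then show ?thesis using IVT'[of f u 0 v] assms by (auto simp: mult_less_0_iff)
  next
    case False
    then show ?thesis using IVT2'[of f v 0 u] assms by (auto simp: mult_less_0_iff)
  qed
  then show ?thesis using assms(3) by (metis less_irrefl mult_zero_left mult_zero_right order_le_less)
qed

text \<open>
  An implicit function theorem for a function that is already given: \<open>g w\<close> is the only positive
  root of \<open>F w\<close> at which the \<open>z\<close>-derivative has the sign of \<open>\<sigma>\<close>. The global uniqueness replaces
  the usual local one, and turns every root found near \<open>(w, g w)\<close> into a value of \<open>g\<close>.
\<close>

locale root_branch =
  fixes S :: "real set" and F Fw Fz :: "real \<Rightarrow> real \<Rightarrow> real" and g :: "real \<Rightarrow> real"
    and \<sigma> :: real
  assumes S: "open S"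
    and Fz: "\<And>w z. w \<in> S \<Longrightarrow> z > 0 \<Longrightarrow> (F w has_real_derivative Fz w z) (at z)"
    and Fw: "\<And>w z. w \<in> S \<Longrightarrow> z > 0 \<Longrightarrow> ((\<lambda>w. F w z) has_real_derivative Fw w z) (at w)"
    and cont: "\<And>w z. w \<in> S \<Longrightarrow> z > 0 \<Longrightarrow> isCont (\<lambda>(w, z). Fz w z) (w, z)"
    and root: "\<And>w. w \<in> S \<Longrightarrow> g w > 0 \<and> F w (g w) = 0 \<and> \<sigma> * Fz w (g w) > 0"
    and unique: "\<And>w z. w \<in> S \<Longrightarrow> z > 0 \<Longrightarrow> F w z = 0 \<Longrightarrow> \<sigma> * Fz w z > 0 \<Longrightarrow> z = g w"
begin

text \<open>
  \<open>\<sigma> * F w0\<close> increases near its root \<open>g w0\<close>, so it has opposite signs slightly below and slightly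
  above. For \<open>w\<close> near \<open>w0\<close> the signs persist, hence \<open>F w\<close> has a root in between, and it is \<open>g w\<close>.
\<close>

lemma branch_isCont:
  assumes w0: "w0 \<in> S"
  shows "isCont g w0"
  unfolding isCont_def tendsto_iff
proof (intro allI impI)
  fix e :: real
  assume "e > 0"
  define z0 where "z0 = g w0"
  have z0: "z0 > 0" "F w0 z0 = 0" "\<sigma> * Fz w0 z0 > 0"
    using root[OF w0] by (auto simp: z0_def)
  have "isCont (\<lambda>p. \<sigma> * (case p of (w, z) \<Rightarrow> Fz w z)) (w0, z0)"
    using cont[OF w0 z0(1)] by (intro continuous_intros)
  then obtain d1 where d1: "d1 > 0"
    "\<And>w z. \<bar>w - w0\<bar> < d1 \<Longrightarrow> \<bar>z - z0\<bar> < d1 \<Longrightarrow> \<sigma> * Fz w z > 0"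
    using isCont_pos_box[of w0 z0 "\<lambda>p. \<sigma> * (case p of (w, z) \<Rightarrow> Fz w z)"] z0(3) by auto
  \<comment> \<open>The interval of radius \<open>r\<close> about \<open>z0\<close> is positive, is within \<open>e\<close>, and keeps the sign of \<open>Fz\<close>.\<close>
  define r where "r = Min {e, d1, z0} / 2"
  have r: "r > 0" "r < e" "r < d1" "r < z0"
    using \<open>e > 0\<close> d1(1) z0(1) by (auto simp: r_def min_def)
  have incr: "\<sigma> * F w0 u < \<sigma> * F w0 v" if "z0 - r \<le> u" "u < v" "v \<le> z0 + r" for u v
  proof (rule DERIV_pos_imp_increasing[OF \<open>u < v\<close>])
    fix z assume z: "u \<le> z" "z \<le> v"
    then have "((\<lambda>z. \<sigma> * F w0 z) has_real_derivative \<sigma> * Fz w0 z) (at z)"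
      using that r z Fz[OF w0, of z] by (auto intro!: derivative_eq_intros)
    moreover have "\<sigma> * Fz w0 z > 0"
      using d1(2)[of w0 z] d1(1) that z r by auto
    ultimately show "\<exists>y. ((\<lambda>z. \<sigma> * F w0 z) has_real_derivative y) (at z) \<and> 0 < y" by blast
  qed
  have ends: "\<sigma> * F w0 (z0 - r) < 0" "\<sigma> * F w0 (z0 + r) > 0"
    using incr[of "z0 - r" z0] incr[of z0 "z0 + r"] z0 r by auto
  have near: "((\<lambda>w. \<sigma> * F w z) \<longlongrightarrow> \<sigma> * F w0 z) (at w0)" if "z > 0" for z
    using DERIV_isCont[OF Fw[OF w0 that]] by (auto simp: isCont_def intro!: tendsto_intros)
  have "\<forall>\<^sub>F w in at w0. \<sigma> * F w (z0 - r) < 0" "\<forall>\<^sub>F w in at w0. \<sigma> * F w (z0 + r) > 0"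
    using order_tendstoD(2)[OF near ends(1)] order_tendstoD(1)[OF near ends(2)] r z0 by auto
  moreover have "\<forall>\<^sub>F w in at w0. w \<in> S"
    using S w0 by (auto simp: eventually_at_topological)
  moreover have "\<forall>\<^sub>F w in at w0. \<bar>w - w0\<bar> < d1"
    unfolding eventually_at using d1(1) by (auto simp: dist_real_def)
  ultimately show "\<forall>\<^sub>F w in at w0. dist (g w) (g w0) < e"
  proof eventually_elim
    case (elim w)
    have "continuous_on {z0 - r..z0 + r} (F w)"
      using Fz[OF elim(3)] r by (auto intro!: DERIV_continuous_on[of _ _ "Fz w"]
          intro: has_field_derivative_at_within)
    moreover have "F w (z0 - r) * F w (z0 + r) < 0"
      using elim(1,2) by (auto simp: mult_less_0_iff zero_less_mult_iff)
    ultimately obtain z where z: "z0 - r < z" "z < z0 + r" "F w z = 0"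
      using root_between[of "z0 - r" "z0 + r" "F w"] r by auto
    have "z = g w"
      using unique[OF elim(3) _ z(3)] d1(2)[OF elim(4), of z] z r by auto
    then show ?case using z r by (auto simp: dist_real_def z0_def)
  qed
qed

text \<open>
  By the mean value theorem, \<open>(g w - g w0) * Fz w \<xi> = F w (g w) - F w (g w0) = - F w (g w0)\<close> for some
  \<open>\<xi>\<close> between \<open>g w0\<close> and \<open>g w\<close>. Division by \<open>w - w0\<close> and passage to the limit give the derivative.
\<close>

lemma branch_derivative:
  assumes w0: "w0 \<in> S"
  shows "(g has_real_derivative - Fw w0 (g w0) / Fz w0 (g w0)) (at w0)"
proof -
  define z0 where "z0 = g w0"
  have z0: "z0 > 0" "F w0 z0 = 0" "Fz w0 z0 \<noteq> 0"
    using root[OF w0] by (auto simp: z0_def)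
  have inS: "\<forall>\<^sub>F w in at w0. w \<in> S"
    using S w0 by (auto simp: eventually_at_topological)
  have "\<exists>\<xi>. \<bar>\<xi> - z0\<bar> \<le> \<bar>g w - z0\<bar> \<and> F w (g w) - F w z0 = (g w - z0) * Fz w \<xi>" if w: "w \<in> S" for w
  proof -
    consider "g w = z0" | "g w < z0" | "z0 < g w" by linarith
    then show ?thesis
    proof cases
      case 1
      then show ?thesis by auto
    next
      case 2
      then obtain \<xi> where "g w < \<xi>" "\<xi> < z0" "F w z0 - F w (g w) = (z0 - g w) * Fz w \<xi>"
        using MVT2[of "g w" z0 "F w" "Fz w"] Fz[OF w] root[OF w] by auto
      then show ?thesis by (intro exI[of _ \<xi>]) (auto simp: algebra_simps)
    next
      case 3
      then obtain \<xi> where "z0 < \<xi>" "\<xi> < g w" "F w (g w) - F w z0 = (g w - z0) * Fz w \<xi>"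
        using MVT2[of z0 "g w" "F w" "Fz w"] Fz[OF w] z0 by auto
      then show ?thesis by (intro exI[of _ \<xi>]) auto
    qed
  qed
  then obtain \<xi> where \<xi>: "\<And>w. w \<in> S \<Longrightarrow> \<bar>\<xi> w - z0\<bar> \<le> \<bar>g w - z0\<bar>"
    "\<And>w. w \<in> S \<Longrightarrow> F w (g w) - F w z0 = (g w - z0) * Fz w (\<xi> w)" by metis
  have "((\<lambda>w. g w - z0) \<longlongrightarrow> 0) (at w0)"
    using branch_isCont[OF w0] by (simp add: isCont_def z0_def LIM_zero_iff)
  then have "((\<lambda>w. \<xi> w - z0) \<longlongrightarrow> 0) (at w0)"
    by (rule Lim_null_comparison[rotated, OF tendsto_rabs_zero])
      (use inS \<xi>(1) in \<open>auto elim: eventually_mono\<close>)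
  then have "(\<xi> \<longlongrightarrow> z0) (at w0)" by (simp add: LIM_zero_iff)
  then have "((\<lambda>w. (w, \<xi> w)) \<longlongrightarrow> (w0, z0)) (at w0)" by (intro tendsto_intros)
  then have slope: "((\<lambda>w. Fz w (\<xi> w)) \<longlongrightarrow> Fz w0 z0) (at w0)"
    using isCont_tendsto_compose[OF cont[OF w0 z0(1)]] by fastforce
  have "((\<lambda>w. (F w z0 - F w0 z0) / (w - w0)) \<longlongrightarrow> Fw w0 z0) (at w0)"
    using Fw[OF w0 z0(1)] by (simp add: has_field_derivative_iff)
  then have lim: "((\<lambda>w. - ((F w z0 - F w0 z0) / (w - w0)) / Fz w (\<xi> w)) \<longlongrightarrow>
      - Fw w0 z0 / Fz w0 z0) (at w0)"
    using slope z0(3) by (intro tendsto_intros)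
  have "\<forall>\<^sub>F w in at w0. Fz w (\<xi> w) \<noteq> 0"
    using slope z0(3) by (rule tendsto_imp_eventually_ne)
  with inS have "\<forall>\<^sub>F w in at w0.
      - ((F w z0 - F w0 z0) / (w - w0)) / Fz w (\<xi> w) = (g w - g w0) / (w - w0)"
  proof eventually_elim
    case (elim w)
    have "(g w - z0) * Fz w (\<xi> w) = - F w z0"
      using \<xi>(2)[OF elim(1)] root[OF elim(1)] by simp
    then have "g w - z0 = - F w z0 / Fz w (\<xi> w)"
      using elim(2) by (simp add: field_simps)
    then show ?case using z0(2) by (simp add: z0_def)
  qed
  then show ?thesis
    using lim unfolding has_field_derivative_iff z0_def[symmetric]
    using tendsto_cong by fastforce
qed

text \<open>
  If \<open>g\<close> is differentiable \<open>n\<close> times, then so is \<open>- Fw w (g w) / Fz w (g w)\<close>, which is its derivative.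
\<close>

lemma branch_smooth:
  assumes "\<And>n h. smooth_upto n S h \<Longrightarrow> smooth_upto n S (\<lambda>w. Fw w (h w))"
    and "\<And>n h. smooth_upto n S h \<Longrightarrow> smooth_upto n S (\<lambda>w. Fz w (h w))"
  shows "C_infinity_on S g"
proof -
  have "smooth_upto n S g" for n
  proof (induction n)
    case (Suc n)
    have "smooth_upto n S (\<lambda>w. (- 1) * (Fw w (g w) * inverse (Fz w (g w))))"
      using root Suc assms
      by (intro smooth_upto_mult smooth_upto_const smooth_upto_inverse) force+
    moreover have "\<forall>w\<in>S. (g has_real_derivative
        (- 1) * (Fw w (g w) * inverse (Fz w (g w)))) (at w)"
      using branch_derivative by (simp add: divide_inverse)
    ultimately show ?case by auto
  qed simp
  then show ?thesis using S by (simp add: C_infinity_on_iff_smooth_upto)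
qed

end

section \<open>Shapes and curves of shapes\<close>

lemma inertia_vector:
  "inertia m (vector [a, b, c]) = (m$1 * m$2 * c + m$2 * m$3 * a + m$3 * m$1 * b) / (m$1 + m$2 + m$3)"
  by (simp add: inertia_def)

lemma inertia_pos:
  assumes "m$1 > 0" "m$2 > 0" "m$3 > 0" "a \<ge> 0" "b \<ge> 0" "c \<ge> 0" "a + b + c > 0"
  shows "inertia m (vector [a, b, c]) > 0"
proof -
  have nonneg: "m$1 * m$2 * c \<ge> 0" "m$2 * m$3 * a \<ge> 0" "m$3 * m$1 * b \<ge> 0"
    using assms by simp_all
  have "c > 0 \<or> a > 0 \<or> b > 0" using assms by linarith
  then have "m$1 * m$2 * c > 0 \<or> m$2 * m$3 * a > 0 \<or> m$3 * m$1 * b > 0"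
    using assms by auto
  then have "m$1 * m$2 * c + m$2 * m$3 * a + m$3 * m$1 * b > 0" using nonneg by linarith
  then show ?thesis using assms by (simp add: inertia_vector)
qed

lemma shape_nth:
  "shape m \<kappa> a b c $ 1 = \<kappa> / inertia m (vector [a, b, c]) * a"
  "shape m \<kappa> a b c $ 2 = \<kappa> / inertia m (vector [a, b, c]) * b"
  "shape m \<kappa> a b c $ 3 = \<kappa> / inertia m (vector [a, b, c]) * c"
  by (simp_all add: shape_def)

lemma shape_scale:
  assumes "k \<noteq> 0"
  shows "shape m \<kappa> (k * a) (k * b) (k * c) = shape m \<kappa> a b c"
proof -
  have "inertia m (vector [k * a, k * b, k * c]) = k * inertia m (vector [a, b, c])"
    by (simp add: inertia_vector algebra_simps add_divide_distrib)
  then show ?thesis using assms by (simp add: vec_eq_iff forall_3 shape_nth)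
qed

lemma shape_tendsto:
  assumes "(a \<longlongrightarrow> a0) F" "(b \<longlongrightarrow> b0) F" "(c \<longlongrightarrow> c0) F"
    and "inertia m (vector [a0, b0, c0]) \<noteq> 0"
  shows "((\<lambda>w. shape m \<kappa> (a w) (b w) (c w)) \<longlongrightarrow> shape m \<kappa> a0 b0 c0) F"
proof -
  have M: "m$1 + m$2 + m$3 \<noteq> 0" using assms(4) by (auto simp: inertia_vector)
  have I: "((\<lambda>w. inertia m (vector [a w, b w, c w])) \<longlongrightarrow> inertia m (vector [a0, b0, c0])) F"
    unfolding inertia_vector using M by (intro tendsto_intros assms(1-3))
  have "\<forall>i. ((\<lambda>w. shape m \<kappa> (a w) (b w) (c w) $ i) \<longlongrightarrow> shape m \<kappa> a0 b0 c0 $ i) F"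
    unfolding forall_3 shape_nth by (intro conjI tendsto_intros I assms)
  then show ?thesis by (simp add: vec_tendstoI)
qed

text \<open>
  The filters \<open>F\<close> and \<open>G\<close> stand for the two ends of the interval \<open>S\<close>, finite or infinite.
\<close>

definition interval_param ::
    "real set \<Rightarrow> real filter \<Rightarrow> real filter \<Rightarrow> (real \<Rightarrow> real) \<Rightarrow> bool" where
  "interval_param S F G \<phi> \<longleftrightarrow>
     C_infinity_on {0<..<1} \<phi> \<and> inj_on \<phi> {0<..<1} \<and> \<phi> ` {0<..<1} = S \<and>
     (\<forall>t\<in>{0<..<1}. \<exists>d\<noteq>0. (\<phi> has_real_derivative d) (at t)) \<and>
     filterlim \<phi> F (at_right 0) \<and> filterlim \<phi> G (at_left 1)"

lemma interval_param_halfline: "interval_param {p<..} (at_right p) at_top (\<lambda>t. p + t / (1 - t))"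
  unfolding interval_param_def
proof (intro conjI ballI)
  show "C_infinity_on {0<..<1} (\<lambda>t. p + t / (1 - t))"
    by (intro C_infinity_intros) auto
  show "inj_on (\<lambda>t. p + t / (1 - t)) {0<..<1}"
    by (auto simp: inj_on_def field_simps)
  show "(\<lambda>t. p + t / (1 - t)) ` {0<..<1} = {p<..}"
  proof (intro equalityI subsetI)
    fix x assume "x \<in> {p<..}"
    then have "x = p + ((x - p) / (1 + x - p)) / (1 - (x - p) / (1 + x - p))"
      "(x - p) / (1 + x - p) \<in> {0<..<1}"
      by (auto simp: field_simps)
    then show "x \<in> (\<lambda>t. p + t / (1 - t)) ` {0<..<1}" by blast
  qed auto
  show "\<exists>d\<noteq>0. ((\<lambda>t. p + t / (1 - t)) has_real_derivative d) (at t)" if "t \<in> {0<..<1}" for t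
  proof -
    have "((\<lambda>t. p + t / (1 - t)) has_real_derivative 1 / (1 - t)^2) (at t)"
      using that by (auto intro!: derivative_eq_intros simp: power2_eq_square)
    then show ?thesis using that by (intro exI[of _ "1 / (1 - t)^2"]) auto
  qed
  have "((\<lambda>t. p + t / (1 - t)) \<longlongrightarrow> p + 0 / (1 - 0)) (at_right 0)"
    by (intro tendsto_intros) auto
  moreover have "\<forall>\<^sub>F t in at_right 0. p + t / (1 - t) > p"
    unfolding eventually_at_right_field by (intro exI[of _ 1]) auto
  ultimately show "filterlim (\<lambda>t. p + t / (1 - t)) (at_right p) (at_right 0)"
    by (auto simp: filterlim_at elim: eventually_mono)
  have "\<forall>\<^sub>F t in at_left 1. t < (1::real)" by (simp add: eventually_at_filter)
  moreover have "((\<lambda>t. 1 - t) \<longlongrightarrow> 1 - (1::real)) (at_left 1)" by (intro tendsto_intros)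
  ultimately have "filterlim (\<lambda>t::real. 1 - t) (at_right 0) (at_left 1)"
    unfolding filterlim_at by (auto elim: eventually_mono)
  then have "filterlim (\<lambda>t. t / (1 - t)) at_top (at_left (1::real))"
    by (intro LIM_at_top_divide[of _ 1])
      (auto simp: filterlim_at eventually_conj_iff intro: tendsto_intros)
  then show "filterlim (\<lambda>t. p + t / (1 - t)) at_top (at_left 1)"
    by (intro filterlim_tendsto_add_at_top[of _ p]) auto
qed

lemma interval_param_segment:
  assumes "r > 0"
  shows "interval_param {0<..<r} (at_right 0) (at_left r) (\<lambda>t. r * t)"
  unfolding interval_param_def
proof (intro conjI ballI)
  show "C_infinity_on {0<..<1} (\<lambda>t. r * t)" by (intro C_infinity_intros) auto
  show "inj_on (\<lambda>t. r * t) {0<..<1}" using assms by (auto simp: inj_on_def)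
  show "(\<lambda>t. r * t) ` {0<..<1} = {0<..<r}"
  proof (intro equalityI subsetI)
    fix x assume "x \<in> {0<..<r}"
    then have "x = r * (x / r)" "x / r \<in> {0<..<1}" by auto
    then show "x \<in> (\<lambda>t. r * t) ` {0<..<1}" by blast
  qed (use assms in auto)
  show "\<exists>d\<noteq>0. ((\<lambda>t. r * t) has_real_derivative d) (at t)" for t
    using assms by (intro exI[of _ r]) (auto intro!: derivative_eq_intros)
  have "((\<lambda>t. r * t) \<longlongrightarrow> r * 0) (at_right 0)" "((\<lambda>t. r * t) \<longlongrightarrow> r * 1) (at_left 1)"
    by (intro tendsto_intros)+
  then show "filterlim (\<lambda>t. r * t) (at_right 0) (at_right 0)"
    "filterlim (\<lambda>t. r * t) (at_left r) (at_left 1)"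
    using assms unfolding filterlim_at
    by (simp_all add: eventually_at_filter)
qed

text \<open>
  Curves of shapes are constructed in the plane of the distance ratios \<open>(x, y)\<close>, where the third
  distance is 1. The ratio of two components of a shape recovers \<open>x\<^sup>2\<close> or \<open>y\<^sup>2\<close>. As one of \<open>x\<close>, \<open>y\<close> is
  the parameter itself, this ratio shows both that the curve is injective and that its velocity does
  not vanish.
\<close>

lemma smooth_curve_of_plane_curve:
  fixes m :: "real^3" and x y :: "real \<Rightarrow> real"
  assumes m: "m$1 > 0" "m$2 > 0" "m$3 > 0" and \<kappa>: "\<kappa> > 0"
    and S: "open S" and par: "interval_param S F G \<phi>"
    and x: "C_infinity_on S x" "\<And>w. w \<in> S \<Longrightarrow> x w > 0"
    and y: "C_infinity_on S y" "\<And>w. w \<in> S \<Longrightarrow> y w > 0"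
    and graph: "(\<forall>w\<in>S. x w = w) \<or> (\<forall>w\<in>S. y w = w)"
    and P: "((\<lambda>w. shape m \<kappa> ((x w)\<^sup>2) ((y w)\<^sup>2) 1) \<longlongrightarrow> P) F"
    and Q: "((\<lambda>w. shape m \<kappa> ((x w)\<^sup>2) ((y w)\<^sup>2) 1) \<longlongrightarrow> Q) G"
  shows "\<exists>\<gamma>. smooth_curve_with_ends \<gamma> P Q \<and>
    \<gamma> ` {0<..<1} = (\<lambda>w. shape m \<kappa> ((x w)\<^sup>2) ((y w)\<^sup>2) 1) ` S"
proof -
  define sh where "sh w = shape m \<kappa> ((x w)\<^sup>2) ((y w)\<^sup>2) 1" for w
  define N where "N w = inertia m (vector [(x w)\<^sup>2, (y w)\<^sup>2, 1])" for w
  define \<gamma> where "\<gamma> t = sh (\<phi> t)" for t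
  have \<phi>: "C_infinity_on {0<..<1} \<phi>" "inj_on \<phi> {0<..<1}" "\<phi> ` {0<..<1} = S"
    "\<And>t. t \<in> {0<..<1} \<Longrightarrow> \<exists>d. d \<noteq> 0 \<and> (\<phi> has_real_derivative d) (at t)"
    "filterlim \<phi> F (at_right 0)" "filterlim \<phi> G (at_left 1)"
    using par unfolding interval_param_def by auto
  have \<phi>S: "\<phi> t \<in> S" if "t \<in> {0<..<1}" for t using \<phi>(3) that by auto
  have N: "N w > 0" for w
    unfolding N_def using m by (intro inertia_pos) (auto simp: add_nonneg_pos)
  have sh_nth: "sh w $ 1 = \<kappa> / N w * (x w)\<^sup>2" "sh w $ 2 = \<kappa> / N w * (y w)\<^sup>2"
    "sh w $ 3 = \<kappa> / N w" for w
    by (simp_all add: sh_def N_def shape_nth)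
  have N_smooth: "C_infinity_on S N"
    unfolding N_def inertia_vector using m by (intro C_infinity_intros S x y) auto
  have nth: "\<forall>i. C_infinity_on S (\<lambda>w. sh w $ i)"
    unfolding forall_3 sh_nth using N
    by (intro conjI C_infinity_intros S x y N_smooth) (auto simp: less_imp_neq[symmetric])
  have smooth: "C_infinity_on {0<..<1} \<gamma>"
    unfolding \<gamma>_def
    by (rule C_infinity_on_vec) (rule C_infinity_on_compose[OF _ S spec[OF nth] \<phi>(1) \<phi>S], auto)
  have ratio: "\<gamma> t $ 1 / \<gamma> t $ 3 = (x (\<phi> t))\<^sup>2" "\<gamma> t $ 2 / \<gamma> t $ 3 = (y (\<phi> t))\<^sup>2"
    "\<gamma> t $ 3 \<noteq> 0" for t
    using N[of "\<phi> t"] \<kappa> by (simp_all add: \<gamma>_def sh_nth)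
  have ratio_w: "\<exists>i. \<forall>t\<in>{0<..<1}. \<gamma> t $ i / \<gamma> t $ 3 = (\<phi> t)\<^sup>2"
    using graph
  proof
    assume "\<forall>w\<in>S. x w = w"
    then show ?thesis using ratio(1) \<phi>S by (intro exI[of _ 1]) simp
  next
    assume "\<forall>w\<in>S. y w = w"
    then show ?thesis using ratio(2) \<phi>S by (intro exI[of _ 2]) simp
  qed
  then obtain i where i: "\<And>t. t \<in> {0<..<1} \<Longrightarrow> \<gamma> t $ i / \<gamma> t $ 3 = (\<phi> t)\<^sup>2"
    by blast
  have \<phi>_pos: "\<phi> t > 0" if "t \<in> {0<..<1}" for t
    using graph x(2)[OF \<phi>S[OF that]] y(2)[OF \<phi>S[OF that]] \<phi>S[OF that] by auto
  have inj: "inj_on \<gamma> {0<..<1}"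
  proof (rule inj_onI)
    fix s t assume st: "s \<in> {0<..<1}" "t \<in> {0<..<1}" "\<gamma> s = \<gamma> t"
    then have "(\<phi> s)\<^sup>2 = (\<phi> t)\<^sup>2" using i[OF st(1)] i[OF st(2)] by simp
    then have "\<phi> s = \<phi> t" using \<phi>_pos st(1,2) by (simp add: power2_eq_iff_nonneg less_imp_le)
    then show "s = t" using \<phi>(2) st by (auto simp: inj_on_def)
  qed
  have velocity: "vector_derivative \<gamma> (at t) \<noteq> 0" if t: "t \<in> {0<..<1}" for t
  proof
    assume "vector_derivative \<gamma> (at t) = 0"
    moreover have "\<gamma> differentiable (at t)"
      using smooth t differentiableI_vector unfolding C_infinity_on_def by blast
    ultimately have "(\<gamma> has_vector_derivative 0) (at t)"
      by (simp add: vector_derivative_works)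
    then have "((\<lambda>t. \<gamma> t $ j) has_real_derivative 0) (at t)" for j
      using bounded_linear.has_vector_derivative[OF bounded_linear_vec_nth[of j], of \<gamma> 0 "at t"]
      by (simp add: has_real_derivative_iff_has_vector_derivative)
    then have "((\<lambda>t. \<gamma> t $ i / \<gamma> t $ 3) has_real_derivative 0) (at t)"
      using ratio(3)[of t] by (auto intro!: derivative_eq_intros)
    then have "((\<lambda>t. (\<phi> t)\<^sup>2) has_real_derivative 0) (at t)"
      using has_field_derivative_transform_within_open[of _ 0 t "{0<..<1}" "\<lambda>t. (\<phi> t)\<^sup>2"] i t
      by auto
    moreover obtain d where d: "d \<noteq> 0" "(\<phi> has_real_derivative d) (at t)" using \<phi>(4)[OF t] by auto
    moreover have "((\<lambda>t. (\<phi> t)\<^sup>2) has_real_derivative 2 * \<phi> t * d) (at t)"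
      using d(2) by (auto intro!: derivative_eq_intros)
    ultimately have "2 * \<phi> t * d = 0" using DERIV_unique by blast
    then show False using d(1) \<phi>_pos[OF t] by simp
  qed
  have "(\<gamma> \<longlongrightarrow> P) (at_right 0)" "(\<gamma> \<longlongrightarrow> Q) (at_left 1)"
    unfolding \<gamma>_def sh_def using filterlim_compose[OF P \<phi>(5)] filterlim_compose[OF Q \<phi>(6)] by auto
  moreover have "\<gamma> ` {0<..<1} = sh ` S"
    using \<phi>(3) by (auto simp: \<gamma>_def)
  ultimately show ?thesis
    using smooth inj velocity unfolding smooth_curve_with_ends_def sh_def[symmetric]
    by (intro exI[of _ \<gamma>]) simp
qed

lemma shape_end_finite:
  assumes "m$1 > 0" "m$2 > 0" "m$3 > 0" and "(x \<longlongrightarrow> x0) F" "(y \<longlongrightarrow> y0) F"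
  shows "((\<lambda>w. shape m \<kappa> ((x w)\<^sup>2) ((y w)\<^sup>2) 1) \<longlongrightarrow> shape m \<kappa> (x0\<^sup>2) (y0\<^sup>2) 1) F"
proof -
  have "inertia m (vector [x0\<^sup>2, y0\<^sup>2, 1]) > 0"
    using assms by (intro inertia_pos) (auto simp: add_nonneg_pos)
  then show ?thesis using assms by (intro shape_tendsto tendsto_intros) auto
qed

text \<open>
  When a distance ratio becomes infinite, the shape is rescaled by it before the limit is taken.
\<close>

lemma shape_end_x_infinite:
  assumes "m$1 > 0" "m$2 > 0" "m$3 > 0"
    and "filterlim x at_top F" "((\<lambda>w. y w / x w) \<longlongrightarrow> u) F"
  shows "((\<lambda>w. shape m \<kappa> ((x w)\<^sup>2) ((y w)\<^sup>2) 1) \<longlongrightarrow> shape m \<kappa> 1 (u\<^sup>2) 0) F"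
proof -
  have pos: "\<forall>\<^sub>F w in F. x w > 0" using assms(4) by (simp add: filterlim_at_top_dense)
  have "((\<lambda>w. 1 / x w) \<longlongrightarrow> 0) F"
    using tendsto_inverse_0_at_top[OF assms(4)] by (simp add: inverse_eq_divide)
  then have z: "((\<lambda>w. (1 / x w)\<^sup>2) \<longlongrightarrow> 0\<^sup>2) F" by (rule tendsto_power)
  have "inertia m (vector [1, u\<^sup>2, 0\<^sup>2]) > 0"
    using assms by (intro inertia_pos) (auto simp: add_pos_nonneg)
  then have "((\<lambda>w. shape m \<kappa> 1 ((y w / x w)\<^sup>2) ((1 / x w)\<^sup>2)) \<longlongrightarrow> shape m \<kappa> 1 (u\<^sup>2) (0\<^sup>2)) F"
    using z by (intro shape_tendsto tendsto_const tendsto_power assms) auto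
  moreover have "\<forall>\<^sub>F w in F. shape m \<kappa> 1 ((y w / x w)\<^sup>2) ((1 / x w)\<^sup>2) = shape m \<kappa> ((x w)\<^sup>2) ((y w)\<^sup>2) 1"
    using pos
  proof eventually_elim
    case (elim w)
    then show ?case
      using shape_scale[of "(x w)\<^sup>2" m \<kappa> 1 "(y w / x w)\<^sup>2" "(1 / x w)\<^sup>2"] by (simp add: power_divide)
  qed
  ultimately show ?thesis using Lim_transform_eventually by fastforce
qed

lemma shape_end_y_infinite:
  assumes "m$1 > 0" "m$2 > 0" "m$3 > 0" and "(x \<longlongrightarrow> x0) F" "filterlim y at_top F"
  shows "((\<lambda>w. shape m \<kappa> ((x w)\<^sup>2) ((y w)\<^sup>2) 1) \<longlongrightarrow> shape m \<kappa> 0 1 0) F"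
proof -
  have pos: "\<forall>\<^sub>F w in F. y w > 0" using assms(5) by (simp add: filterlim_at_top_dense)
  have inv: "((\<lambda>w. 1 / y w) \<longlongrightarrow> 0) F"
    using tendsto_inverse_0_at_top[OF assms(5)] by (simp add: inverse_eq_divide)
  then have z: "((\<lambda>w. (1 / y w)\<^sup>2) \<longlongrightarrow> 0\<^sup>2) F" by (rule tendsto_power)
  have "((\<lambda>w. x w * (1 / y w)) \<longlongrightarrow> x0 * 0) F" by (intro tendsto_mult assms inv)
  then have xz: "((\<lambda>w. (x w / y w)\<^sup>2) \<longlongrightarrow> 0\<^sup>2) F" by (intro tendsto_power) simp
  have "inertia m (vector [0\<^sup>2, 1, 0\<^sup>2]) > 0"
    using assms by (intro inertia_pos) auto
  then have "((\<lambda>w. shape m \<kappa> ((x w / y w)\<^sup>2) 1 ((1 / y w)\<^sup>2)) \<longlongrightarrow> shape m \<kappa> (0\<^sup>2) 1 (0\<^sup>2)) F"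
    using z xz by (intro shape_tendsto tendsto_const) auto
  moreover have "\<forall>\<^sub>F w in F. shape m \<kappa> ((x w / y w)\<^sup>2) 1 ((1 / y w)\<^sup>2) = shape m \<kappa> ((x w)\<^sup>2) ((y w)\<^sup>2) 1"
    using pos
  proof eventually_elim
    case (elim w)
    then show ?case
      using shape_scale[of "(y w)\<^sup>2" m \<kappa> "(x w / y w)\<^sup>2" 1 "(1 / y w)\<^sup>2"] by (simp add: power_divide)
  qed
  ultimately show ?thesis using Lim_transform_eventually by fastforce
qed

section \<open>Balanced configurations as zeros of a polynomial in the distances\<close>

text \<open>
  The variables are the distances themselves, \<open>x\<^sup>2 = a\<close>, \<open>y\<^sup>2 = b\<close>, \<open>z\<^sup>2 = c\<close>, which makes the powers
  \<open>a\<close> to the \<open>-3/2\<close> etc. rational.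
\<close>

definition balance_poly :: "real^3 \<Rightarrow> real \<Rightarrow> real \<Rightarrow> real \<Rightarrow> real" where
  "balance_poly m x y z =
     m$1 * (y\<^sup>2 + z\<^sup>2 - x\<^sup>2) * x^3 * (z^3 - y^3) +
     m$2 * (z\<^sup>2 + x\<^sup>2 - y\<^sup>2) * y^3 * (x^3 - z^3) +
     m$3 * (x\<^sup>2 + y\<^sup>2 - z\<^sup>2) * z^3 * (y^3 - x^3)"

lemma balance_poly_scale: "balance_poly m (k * x) (k * y) (k * z) = k ^ 8 * balance_poly m x y z"
proof -
  have "k ^ 8 = k\<^sup>2 * (k ^ 3 * k ^ 3)" by (simp flip: power_add)
  then show ?thesis unfolding balance_poly_def power_mult_distrib by (simp only: algebra_simps)
qed

lemma balance_poly_0: "balance_poly m 0 z 1 = (m$2 + m$3) * z^3 * (z\<^sup>2 - 1)"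
  unfolding balance_poly_def by (simp add: algebra_simps)

lemma balance_poly_infinity: "balance_poly m 1 u 0 = (m$1 + m$2) * u^3 * (1 - u\<^sup>2)"
  unfolding balance_poly_def by (simp add: algebra_simps)

lemma balance_poly_isosceles: "balance_poly m w 1 1 = (m$2 - m$3) * w\<^sup>2 * (w^3 - 1)"
  unfolding balance_poly_def by (simp add: algebra_simps)

lemma isCont_balance_poly: "isCont (\<lambda>w. balance_poly m w z 1) w0"
  and isCont_balance_poly_last: "isCont (\<lambda>t. balance_poly m 1 u t) t0"
  unfolding balance_poly_def by (intro continuous_intros)+

lemma power2_powr_neg_3_2:
  fixes x :: real
  assumes "x > 0"
  shows "(x\<^sup>2) powr (-3/2) = 1 / x^3"
proof -
  have "(x\<^sup>2) powr (-3/2) = (x powr 2) powr (-3/2)" using assms by (simp add: powr_numeral)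
  also have "\<dots> = x powr (-3)" by (simp only: powr_powr) simp
  also have "\<dots> = 1 / x^3" using assms by (simp add: powr_minus powr_numeral divide_inverse)
  finally show ?thesis .
qed

lemma det_balance_matrix:
  assumes "x > 0" "y > 0" "z > 0"
  shows "det (balance_matrix m (vector [x\<^sup>2, y\<^sup>2, z\<^sup>2])) * (x * y * z)^3 = balance_poly m x y z"
proof -
  have "(r2 * (1 / C) + r3 * (1 / A) + r1 * (1 / B) - r3 * (1 / B) - r1 * (1 / C) - r2 * (1 / A)) * (A * B * C)
      = r1 * A * (C - B) + r2 * B * (A - C) + r3 * C * (B - A)"
    if "A \<noteq> 0" "B \<noteq> 0" "C \<noteq> 0" for r1 r2 r3 A B C :: real
    using that by (simp add: field_simps)
  from this[of "x ^ 3" "y ^ 3" "z ^ 3"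
      "m$2 * (z\<^sup>2 + x\<^sup>2 - y\<^sup>2)" "m$3 * (x\<^sup>2 + y\<^sup>2 - z\<^sup>2)" "m$1 * (y\<^sup>2 + z\<^sup>2 - x\<^sup>2)"]
  show ?thesis using assms
    unfolding balance_matrix_def balance_poly_def det_3 Let_def vector_3 power_mult_distrib
      power2_powr_neg_3_2[OF assms(1)] power2_powr_neg_3_2[OF assms(2)] power2_powr_neg_3_2[OF assms(3)]
    by (simp add: algebra_simps)
qed

text \<open>
  By homogeneity, a balanced configuration is determined by its two distance ratios.
\<close>

lemma balanced_configurations_eq:
  assumes m: "m$1 > 0" "m$2 > 0" "m$3 > 0" and \<kappa>: "\<kappa> > 0"
  shows "balanced_configurations m \<kappa> =
    {shape m \<kappa> (w\<^sup>2) (z\<^sup>2) 1 |w z. w > 0 \<and> z > 0 \<and> balance_poly m w z 1 = 0}"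
proof (intro equalityI subsetI)
  fix p assume "p \<in> balanced_configurations m \<kappa>"
  then have p: "p$1 > 0" "p$2 > 0" "p$3 > 0" "inertia m p = \<kappa>" "det (balance_matrix m p) = 0"
    by (auto simp: balanced_configurations_def shape_triangle_def)
  define x y z where xyz: "x = sqrt (p$1)" "y = sqrt (p$2)" "z = sqrt (p$3)"
  have pos: "x > 0" "y > 0" "z > 0" using p by (auto simp: xyz)
  have vec: "vector [x\<^sup>2, y\<^sup>2, z\<^sup>2] = p" using p by (simp add: xyz vec_eq_iff forall_3)
  have "balance_poly m x y z = 0" using det_balance_matrix[OF pos, of m] p(5) vec by simp
  moreover have "balance_poly m x y z = z ^ 8 * balance_poly m (x / z) (y / z) 1"
    using balance_poly_scale[of m z "x / z" "y / z" 1] pos by simp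
  ultimately have "balance_poly m (x / z) (y / z) 1 = 0" using pos by simp
  moreover have "shape m \<kappa> ((x / z)\<^sup>2) ((y / z)\<^sup>2) 1 = p"
  proof -
    have "shape m \<kappa> ((x / z)\<^sup>2) ((y / z)\<^sup>2) 1 = shape m \<kappa> (x\<^sup>2) (y\<^sup>2) (z\<^sup>2)"
      using shape_scale[of "z\<^sup>2" m \<kappa> "(x / z)\<^sup>2" "(y / z)\<^sup>2" 1] pos by (simp add: power_divide)
    also have "\<dots> = p" using p \<kappa> vec by (simp add: shape_def)
    finally show ?thesis .
  qed
  ultimately show "p \<in> {shape m \<kappa> (w\<^sup>2) (z\<^sup>2) 1 |w z. w > 0 \<and> z > 0 \<and> balance_poly m w z 1 = 0}"
    using pos unfolding mem_Collect_eq
    by (intro exI[of _ "x / z"] exI[of _ "y / z"] conjI) simp_all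
next
  fix p assume "p \<in> {shape m \<kappa> (w\<^sup>2) (z\<^sup>2) 1 |w z. w > 0 \<and> z > 0 \<and> balance_poly m w z 1 = 0}"
  then obtain w z where wz: "w > 0" "z > 0" "balance_poly m w z 1 = 0" "p = shape m \<kappa> (w\<^sup>2) (z\<^sup>2) 1"
    by auto
  define N where "N = inertia m (vector [w\<^sup>2, z\<^sup>2, 1])"
  have N: "N > 0" unfolding N_def using m by (intro inertia_pos) (auto simp: add_nonneg_pos)
  define k where "k = sqrt (\<kappa> / N)"
  have k: "k > 0" "k\<^sup>2 = \<kappa> / N" using N \<kappa> by (auto simp: k_def)
  have p: "p = vector [(k * w)\<^sup>2, (k * z)\<^sup>2, k\<^sup>2]"
    using k by (simp add: wz(4) vec_eq_iff forall_3 shape_nth N_def power_mult_distrib)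
  have "balance_poly m (k * w) (k * z) (k * 1) = 0"
    using wz(3) by (simp only: balance_poly_scale mult_zero_right)
  then have "det (balance_matrix m p) = 0"
    using det_balance_matrix[of "k * w" "k * z" k m] wz k p by simp
  moreover have "inertia m p = \<kappa>"
  proof -
    have "inertia m p = k\<^sup>2 * N"
      unfolding p N_def inertia_vector by (simp add: algebra_simps add_divide_distrib)
    then show ?thesis using k(2) N by simp
  qed
  ultimately show "p \<in> balanced_configurations m \<kappa>"
    using k(1) wz(1,2) unfolding balanced_configurations_def shape_triangle_def
    by (simp add: p)
qed

section \<open>Positive roots of the quintic\<close>

definition quintic :: "real \<Rightarrow> real \<Rightarrow> real \<Rightarrow> real \<Rightarrow> real \<Rightarrow> real" where
  "quintic L K P Q z = L * z^5 + K * z^3 + P * z^2 + Q"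

definition quintic_deriv :: "real \<Rightarrow> real \<Rightarrow> real \<Rightarrow> real \<Rightarrow> real" where
  "quintic_deriv L K P z = 5 * L * z^4 + 3 * K * z^2 + 2 * P * z"

lemma quintic_has_derivative:
  "(quintic L K P Q has_real_derivative quintic_deriv L K P z) (at z)"
  unfolding quintic_def[abs_def] quintic_deriv_def by (auto intro!: derivative_eq_intros)

lemma continuous_on_quintic: "continuous_on A (quintic L K P Q)"
  unfolding quintic_def[abs_def] by (intro continuous_intros)

text \<open>
  The function \<open>s * quintic L K P Q z / z^2\<close> is strictly convex, so its graph lies above the tangent
  at the root \<open>v\<close>, also over a point \<open>u\<close> where it is at most 0. The identity in the proof is Taylor's
  formula of order 1 at \<open>v\<close> with exact remainder, cleared of denominators.
\<close>

lemma quintic_above_tangent: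
  assumes "s * L \<ge> 0" "s * Q > 0" "u > 0" "v > 0" "u \<noteq> v"
    and "quintic L K P Q v = 0" "s * quintic L K P Q u \<le> 0"
  shows "s * quintic_deriv L K P v * (u - v) < 0"
proof -
  have "v^3 * quintic L K P Q u = u\<^sup>2 * v * quintic L K P Q v
      + (u\<^sup>2 * v * quintic_deriv L K P v - 2 * u\<^sup>2 * quintic L K P Q v) * (u - v)
      + (u - v)\<^sup>2 * (L * (u + 2 * v) * u\<^sup>2 * v^3 + Q * (2 * u + v))"
    unfolding quintic_def quintic_deriv_def by algebra
  then have "v^3 * (s * quintic L K P Q u) = u\<^sup>2 * v * (s * quintic_deriv L K P v * (u - v))
      + (u - v)\<^sup>2 * ((s * L) * ((u + 2 * v) * u\<^sup>2 * v^3) + (s * Q) * (2 * u + v))"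
    using assms(6) by algebra
  moreover have "v^3 * (s * quintic L K P Q u) \<le> 0"
    using mult_nonneg_nonpos[of "v^3" "s * quintic L K P Q u"] assms(4,7) by simp
  moreover have "(u - v)\<^sup>2 * ((s * L) * ((u + 2 * v) * u\<^sup>2 * v^3) + (s * Q) * (2 * u + v)) > 0"
    using assms(3-5)
    by (intro mult_pos_pos[OF _ add_nonneg_pos] mult_nonneg_nonneg[OF assms(1)]
        mult_pos_pos[OF assms(2)]) auto
  ultimately have "u\<^sup>2 * v * (s * quintic_deriv L K P v * (u - v)) < 0" by linarith
  then show ?thesis using assms(3,4) by (simp add: mult_less_0_iff)
qed

text \<open>
  The tangents of a strictly convex function at two of its roots have slopes of opposite signs.
\<close>

lemma quintic_root_unique:
  assumes "s * L \<ge> 0" "s * Q > 0" "u > 0" "v > 0"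
    and "quintic L K P Q u = 0" "quintic L K P Q v = 0"
    and "\<sigma> * quintic_deriv L K P u > 0" "\<sigma> * quintic_deriv L K P v > 0"
  shows "u = v"
proof (rule ccontr)
  assume "u \<noteq> v"
  then have "s * quintic_deriv L K P v * (u - v) < 0" "s * quintic_deriv L K P u * (v - u) < 0"
    using quintic_above_tangent[of s L Q u v K P] quintic_above_tangent[of s L Q v u K P] assms by auto
  then show False using assms(7,8)
    by (auto simp: mult_less_0_iff zero_less_mult_iff)
qed

text \<open>
  If \<open>L \<le> 0\<close> while \<open>Q > 0\<close>, convexity may be lost. Instead, \<open>quintic L K P Q z / z^3\<close>, that is
  \<open>L z^2 + K + P / z + Q / z^3\<close>, is strictly decreasing if \<open>P > 0\<close>.
\<close>

lemma quintic_decreasing_ratio: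
  assumes "L \<le> 0" "P > 0" "Q > 0" "0 < v" "v < u"
  shows "v^3 * quintic L K P Q u < u^3 * quintic L K P Q v"
proof -
  have "v^3 * quintic L K P Q u - u^3 * quintic L K P Q v
      = L * (u^3 * v^3 * (u\<^sup>2 - v\<^sup>2)) - P * (u\<^sup>2 * v\<^sup>2 * (u - v)) - Q * (u^3 - v^3)"
    unfolding quintic_def by algebra
  moreover have "v\<^sup>2 < u\<^sup>2" "v^3 < u^3" using assms by (auto intro: power_strict_mono)
  then have "L * (u^3 * v^3 * (u\<^sup>2 - v\<^sup>2)) \<le> 0" "P * (u\<^sup>2 * v\<^sup>2 * (u - v)) > 0" "Q * (u^3 - v^3) > 0"
    using assms by (auto intro!: mult_nonpos_nonneg mult_nonneg_nonneg)
  ultimately show ?thesis by linarith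
qed

lemma quintic_deriv_neg_at_root:
  assumes "L \<le> 0" "P > 0" "Q > 0" "v > 0" "quintic L K P Q v = 0"
  shows "quintic_deriv L K P v < 0"
proof -
  have "v * quintic_deriv L K P v = 2 * L * v^5 - P * v\<^sup>2 - 3 * Q + 3 * quintic L K P Q v"
    unfolding quintic_def quintic_deriv_def by algebra
  moreover have "L * v^5 \<le> 0" "P * v\<^sup>2 > 0" using assms by (auto intro: mult_nonpos_nonneg)
  ultimately have "v * quintic_deriv L K P v < 0" using assms by linarith
  then show ?thesis using assms by (simp add: mult_less_0_iff)
qed

text \<open>
  The sign of the leading coefficient is read off from \<open>t^5\<close> times the value at \<open>1 / t\<close>, a polynomial
  in \<open>t\<close> with value \<open>L\<close> at 0.
\<close>

lemma quintic_sign_at_infinity: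
  assumes "s * L > 0"
  shows "\<exists>N > M. s * quintic L K P Q N > 0"
proof -
  define h where "h t = s * (L + K * t\<^sup>2 + P * t^3 + Q * t^5)" for t
  have "isCont h 0" unfolding h_def by (intro continuous_intros)
  then have "(h \<longlongrightarrow> h 0) (at_right 0)"
    unfolding isCont_def by (rule filterlim_mono) (auto intro: at_le)
  moreover have "h 0 > 0" using assms by (simp add: h_def)
  ultimately have "\<forall>\<^sub>F t in at_right 0. h t > 0" by (rule order_tendstoD)
  moreover have "\<forall>\<^sub>F t in at_right 0. t < 1 / (\<bar>M\<bar> + 1)"
    unfolding eventually_at_right_field by (intro exI[of _ "1 / (\<bar>M\<bar> + 1)"]) auto
  moreover have "\<forall>\<^sub>F t in at_right 0. t > (0 :: real)"
    by (simp add: eventually_at_right_less)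
  ultimately have "\<forall>\<^sub>F t in at_right (0::real). h t > 0 \<and> t < 1 / (\<bar>M\<bar> + 1) \<and> t > 0"
    by eventually_elim auto
  then obtain t where t: "h t > 0" "t < 1 / (\<bar>M\<bar> + 1)" "t > 0"
    using eventually_happens'[OF trivial_limit_at_right_real] by blast
  have "t^5 * quintic L K P Q (1 / t) = L + K * t\<^sup>2 + P * t^3 + Q * t^5"
    using t(3) by (simp add: quintic_def field_simps flip: power_add)
  then have "t^5 * (s * quintic L K P Q (1 / t)) > 0" using t(1) by (simp add: h_def algebra_simps)
  then have "s * quintic L K P Q (1 / t) > 0" using t(3) by (simp add: zero_less_mult_iff)
  moreover have "1 / t > M"
  proof -
    have "\<bar>M\<bar> + 1 < 1 / t" using t(2,3) by (simp add: field_simps)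
    then show ?thesis by linarith
  qed
  ultimately show ?thesis by blast
qed

text \<open>
  The derivative of a quintic with respect to the parameter of its coefficients is again a polynomial
  in \<open>z\<close> with smooth coefficients, so the inductive argument for implicit functions applies.
\<close>

lemma smooth_quintic_branch:
  fixes L K P Q :: "real \<Rightarrow> real" and \<sigma> :: real
  assumes S: "open S"
    and L: "C_infinity_on S L" and K: "C_infinity_on S K"
    and P: "C_infinity_on S P" and Q: "C_infinity_on S Q"
    and ex: "\<And>w. w \<in> S \<Longrightarrow>
      \<exists>z>0. quintic (L w) (K w) (P w) (Q w) z = 0 \<and> \<sigma> * quintic_deriv (L w) (K w) (P w) z > 0"
    and same: "\<And>w u v. w \<in> S \<Longrightarrow> u > 0 \<Longrightarrow> v > 0 \<Longrightarrow>
      quintic (L w) (K w) (P w) (Q w) u = 0 \<Longrightarrow> quintic (L w) (K w) (P w) (Q w) v = 0 \<Longrightarrow>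
      \<sigma> * quintic_deriv (L w) (K w) (P w) u > 0 \<Longrightarrow>
      \<sigma> * quintic_deriv (L w) (K w) (P w) v > 0 \<Longrightarrow> u = v"
  obtains g where "C_infinity_on S g" "\<And>w. w \<in> S \<Longrightarrow> g w > 0"
    "\<And>w z. w \<in> S \<Longrightarrow> z > 0 \<Longrightarrow> z = g w \<longleftrightarrow>
      quintic (L w) (K w) (P w) (Q w) z = 0 \<and> \<sigma> * quintic_deriv (L w) (K w) (P w) z > 0"
proof -
  obtain g where g: "\<And>w. w \<in> S \<Longrightarrow> g w > 0 \<and> quintic (L w) (K w) (P w) (Q w) (g w) = 0 \<and>
      \<sigma> * quintic_deriv (L w) (K w) (P w) (g w) > 0"
    using ex by metis
  obtain L' where L': "C_infinity_on S L'" "\<And>w. w \<in> S \<Longrightarrow> (L has_real_derivative L' w) (at w)"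
    using C_infinity_on_derivative[OF L] by blast
  obtain K' where K': "C_infinity_on S K'" "\<And>w. w \<in> S \<Longrightarrow> (K has_real_derivative K' w) (at w)"
    using C_infinity_on_derivative[OF K] by blast
  obtain P' where P': "C_infinity_on S P'" "\<And>w. w \<in> S \<Longrightarrow> (P has_real_derivative P' w) (at w)"
    using C_infinity_on_derivative[OF P] by blast
  obtain Q' where Q': "C_infinity_on S Q'" "\<And>w. w \<in> S \<Longrightarrow> (Q has_real_derivative Q' w) (at w)"
    using C_infinity_on_derivative[OF Q] by blast
  define Fw where "Fw w z = L' w * z^5 + K' w * z^3 + P' w * z^2 + Q' w" for w z
  define Fz where "Fz w z = quintic_deriv (L w) (K w) (P w) z" for w z
  interpret root_branch S "\<lambda>w. quintic (L w) (K w) (P w) (Q w)" Fw Fz g \<sigma>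
  proof
    fix w z :: real
    assume w: "w \<in> S" and z: "z > 0"
    show "(quintic (L w) (K w) (P w) (Q w) has_real_derivative Fz w z) (at z)"
      unfolding Fz_def by (rule quintic_has_derivative)
    show "((\<lambda>w. quintic (L w) (K w) (P w) (Q w) z) has_real_derivative Fw w z) (at w)"
      unfolding quintic_def Fw_def
      using L'(2)[OF w] K'(2)[OF w] P'(2)[OF w] Q'(2)[OF w]
      by (auto intro!: derivative_eq_intros)
    have "isCont (\<lambda>p. L (fst p)) (w, z)" "isCont (\<lambda>p. K (fst p)) (w, z)"
      "isCont (\<lambda>p. P (fst p)) (w, z)"
      using L'(2)[OF w] K'(2)[OF w] P'(2)[OF w]
      by (auto intro!: isCont_o2[of _ fst] continuous_intros dest: DERIV_isCont)
    then show "isCont (\<lambda>(w, z). Fz w z) (w, z)"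
      unfolding Fz_def quintic_deriv_def split_def by (intro continuous_intros)
  qed (use S g same in \<open>auto simp: Fz_def\<close>)
  have upto: "smooth_upto n S L" "smooth_upto n S K" "smooth_upto n S P"
    "smooth_upto n S L'" "smooth_upto n S K'" "smooth_upto n S P'" "smooth_upto n S Q'" for n
    using L K P L'(1) K'(1) P'(1) Q'(1) S by (simp_all add: C_infinity_on_iff_smooth_upto)
  have smooth: "C_infinity_on S g"
    by (rule branch_smooth; unfold Fw_def Fz_def quintic_deriv_def;
        intro smooth_upto_add smooth_upto_mult smooth_upto_power smooth_upto_const upto)
  show thesis
  proof (rule that[OF smooth])
    fix w z :: real
    assume w: "w \<in> S"
    show "g w > 0" using g[OF w] by blast
    assume "z > 0"
    then show "z = g w \<longleftrightarrow>
        quintic (L w) (K w) (P w) (Q w) z = 0 \<and> \<sigma> * quintic_deriv (L w) (K w) (P w) z > 0"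
      using g[OF w] same[OF w, of z "g w"] by auto
  qed
qed

section \<open>The conclusion and its symmetry in the three bodies\<close>

text \<open>
  The conclusion of the theorem as a property of the masses, to be transported along permutations.
\<close>

definition three_balanced_curves :: "real^3 \<Rightarrow> real \<Rightarrow> bool" where
  "three_balanced_curves m \<kappa> \<longleftrightarrow>
    (\<exists>\<gamma>\<^sub>1 \<gamma>\<^sub>2 \<gamma>\<^sub>3 P\<^sub>1 Q\<^sub>1 P\<^sub>2 Q\<^sub>2 P\<^sub>3 Q\<^sub>3.
      smooth_curve_with_ends \<gamma>\<^sub>1 P\<^sub>1 Q\<^sub>1 \<and>
      smooth_curve_with_ends \<gamma>\<^sub>2 P\<^sub>2 Q\<^sub>2 \<and>
      smooth_curve_with_ends \<gamma>\<^sub>3 P\<^sub>3 Q\<^sub>3 \<and>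
      {#P\<^sub>1, Q\<^sub>1, P\<^sub>2, Q\<^sub>2, P\<^sub>3, Q\<^sub>3#} =
        {#shape m \<kappa> 1 0 0, shape m \<kappa> 0 1 0, shape m \<kappa> 0 0 1,
          shape m \<kappa> 0 1 1, shape m \<kappa> 1 0 1, shape m \<kappa> 1 1 0#} \<and>
      balanced_configurations m \<kappa> =
        \<gamma>\<^sub>1 ` {0<..<1} \<union> \<gamma>\<^sub>2 ` {0<..<1} \<union> \<gamma>\<^sub>3 ` {0<..<1})"

text \<open>
  It suffices to cover the zero set in the plane of distance ratios by three plane curves.
\<close>

lemma three_balanced_curvesI:
  assumes m: "m$1 > 0" "m$2 > 0" "m$3 > 0" and \<kappa>: "\<kappa> > 0"
    and c1: "\<exists>\<gamma>. smooth_curve_with_ends \<gamma> P\<^sub>1 Q\<^sub>1 \<and>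
      \<gamma> ` {0<..<1} = (\<lambda>w. shape m \<kappa> ((x1 w)\<^sup>2) ((y1 w)\<^sup>2) 1) ` S1"
    and c2: "\<exists>\<gamma>. smooth_curve_with_ends \<gamma> P\<^sub>2 Q\<^sub>2 \<and>
      \<gamma> ` {0<..<1} = (\<lambda>w. shape m \<kappa> ((x2 w)\<^sup>2) ((y2 w)\<^sup>2) 1) ` S2"
    and c3: "\<exists>\<gamma>. smooth_curve_with_ends \<gamma> P\<^sub>3 Q\<^sub>3 \<and>
      \<gamma> ` {0<..<1} = (\<lambda>w. shape m \<kappa> ((x3 w)\<^sup>2) ((y3 w)\<^sup>2) 1) ` S3"
    and ends: "{#P\<^sub>1, Q\<^sub>1, P\<^sub>2, Q\<^sub>2, P\<^sub>3, Q\<^sub>3#} =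
        {#shape m \<kappa> 1 0 0, shape m \<kappa> 0 1 0, shape m \<kappa> 0 0 1,
          shape m \<kappa> 0 1 1, shape m \<kappa> 1 0 1, shape m \<kappa> 1 1 0#}"
    and zeros: "\<And>w z. (w > 0 \<and> z > 0 \<and> balance_poly m w z 1 = 0) \<longleftrightarrow>
      (w, z) \<in> (\<lambda>w. (x1 w, y1 w)) ` S1 \<union> (\<lambda>w. (x2 w, y2 w)) ` S2 \<union> (\<lambda>w. (x3 w, y3 w)) ` S3"
  shows "three_balanced_curves m \<kappa>"
proof -
  obtain \<gamma>1 where \<gamma>1: "smooth_curve_with_ends \<gamma>1 P\<^sub>1 Q\<^sub>1"
    "\<gamma>1 ` {0<..<1} = (\<lambda>w. shape m \<kappa> ((x1 w)\<^sup>2) ((y1 w)\<^sup>2) 1) ` S1" using c1 by blast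
  obtain \<gamma>2 where \<gamma>2: "smooth_curve_with_ends \<gamma>2 P\<^sub>2 Q\<^sub>2"
    "\<gamma>2 ` {0<..<1} = (\<lambda>w. shape m \<kappa> ((x2 w)\<^sup>2) ((y2 w)\<^sup>2) 1) ` S2" using c2 by blast
  obtain \<gamma>3 where \<gamma>3: "smooth_curve_with_ends \<gamma>3 P\<^sub>3 Q\<^sub>3"
    "\<gamma>3 ` {0<..<1} = (\<lambda>w. shape m \<kappa> ((x3 w)\<^sup>2) ((y3 w)\<^sup>2) 1) ` S3" using c3 by blast
  have "balanced_configurations m \<kappa> =
      (\<lambda>(w, z). shape m \<kappa> (w\<^sup>2) (z\<^sup>2) 1) ` {(w, z). w > 0 \<and> z > 0 \<and> balance_poly m w z 1 = 0}"
    unfolding balanced_configurations_eq[OF m \<kappa>] by auto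
  also have "{(w, z). w > 0 \<and> z > 0 \<and> balance_poly m w z 1 = 0} =
      (\<lambda>w. (x1 w, y1 w)) ` S1 \<union> (\<lambda>w. (x2 w, y2 w)) ` S2 \<union> (\<lambda>w. (x3 w, y3 w)) ` S3"
    unfolding zeros by blast
  also have "(\<lambda>(w, z). shape m \<kappa> (w\<^sup>2) (z\<^sup>2) 1) ` \<dots> =
      \<gamma>1 ` {0<..<1} \<union> \<gamma>2 ` {0<..<1} \<union> \<gamma>3 ` {0<..<1}"
    unfolding \<gamma>1(2) \<gamma>2(2) \<gamma>3(2) image_Un image_image by simp
  finally show ?thesis
    unfolding three_balanced_curves_def using \<gamma>1(1) \<gamma>2(1) \<gamma>3(1) ends by blast
qed

lemma C_infinity_ident_pos: "C_infinity_on {0<..} (\<lambda>w. w)"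
  and C_infinity_one_pos: "C_infinity_on {0<..} (\<lambda>w. 1 :: real)"
  by (intro C_infinity_intros; simp)+

lemma image_graph_iff:
  "(w, z) \<in> (\<lambda>w. (w, g w)) ` S \<longleftrightarrow> w \<in> S \<and> z = g w"
  "(w, z) \<in> (\<lambda>z. (h z, z)) ` S \<longleftrightarrow> z \<in> S \<and> w = h z"
  by auto

lemma id_at_right_0: "((\<lambda>w. w) \<longlongrightarrow> (0::real)) (at_right 0)"
  by (rule tendsto_ident_at)

text \<open>
  Linear involutions preserve smooth curves. This is used for the two exchanges of bodies below, under
  which the determinant only changes its sign.
\<close>

lemma three_balanced_curves_of_involution:
  fixes s :: "real^3 \<Rightarrow> real^3"
  assumes s: "bounded_linear s" "\<And>p. s (s p) = p"
    and curves: "three_balanced_curves (s m) \<kappa>"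
    and balanced: "balanced_configurations (s m) \<kappa> = s ` balanced_configurations m \<kappa>"
    and ends: "{#s (shape (s m) \<kappa> 1 0 0), s (shape (s m) \<kappa> 0 1 0), s (shape (s m) \<kappa> 0 0 1),
        s (shape (s m) \<kappa> 0 1 1), s (shape (s m) \<kappa> 1 0 1), s (shape (s m) \<kappa> 1 1 0)#} =
      {#shape m \<kappa> 1 0 0, shape m \<kappa> 0 1 0, shape m \<kappa> 0 0 1,
        shape m \<kappa> 0 1 1, shape m \<kappa> 1 0 1, shape m \<kappa> 1 1 0#}"
  shows "three_balanced_curves m \<kappa>"
proof -
  interpret bounded_linear s by (rule s)
  have curve: "smooth_curve_with_ends (\<lambda>t. s (\<gamma> t)) (s P) (s Q)"
    if \<gamma>: "smooth_curve_with_ends \<gamma> P Q" for \<gamma> P Q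
  proof -
    obtain D where D: "D 0 = \<gamma>"
      "\<forall>n. \<forall>t\<in>{0<..<1}. (D n has_vector_derivative D (Suc n) t) (at t)"
      using \<gamma> unfolding smooth_curve_with_ends_def C_infinity_on_def by blast
    have D': "((\<lambda>t. s (D n t)) has_vector_derivative s (D (Suc n) t)) (at t)"
      if "t \<in> {0<..<1}" for n t
      using D(2) that by (intro has_vector_derivative) auto
    have "C_infinity_on {0<..<1} (\<lambda>t. s (\<gamma> t))"
      unfolding C_infinity_on_def using D(1) D' by (intro exI[of _ "\<lambda>n t. s (D n t)"]) auto
    moreover have "inj_on (\<lambda>t. s (\<gamma> t)) {0<..<1}"
    proof (rule inj_onI)
      fix x y assume xy: "x \<in> {0<..<1}" "y \<in> {0<..<1}" "s (\<gamma> x) = s (\<gamma> y)"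
      then have "\<gamma> x = \<gamma> y" using s(2) by metis
      then show "x = y" using \<gamma> xy unfolding smooth_curve_with_ends_def inj_on_def by blast
    qed
    moreover have "vector_derivative (\<lambda>t. s (\<gamma> t)) (at t) \<noteq> 0" if t: "t \<in> {0<..<1}" for t
    proof -
      have "vector_derivative \<gamma> (at t) = D 1 t"
        using D t by (intro vector_derivative_at) auto
      moreover have "vector_derivative (\<lambda>t. s (\<gamma> t)) (at t) = s (D 1 t)"
        using D(1) D'[OF t, of 0] by (intro vector_derivative_at) auto
      moreover have "vector_derivative \<gamma> (at t) \<noteq> 0"
        using \<gamma> t unfolding smooth_curve_with_ends_def by blast
      ultimately show ?thesis using s(2)[of "D 1 t"] zero by metis
    qed
    moreover have "((\<lambda>t. s (\<gamma> t)) \<longlongrightarrow> s P) (at_right 0)" "((\<lambda>t. s (\<gamma> t)) \<longlongrightarrow> s Q) (at_left 1)"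
      using \<gamma> unfolding smooth_curve_with_ends_def by (auto intro: tendsto)
    ultimately show ?thesis unfolding smooth_curve_with_ends_def by blast
  qed
  obtain \<gamma>1 \<gamma>2 \<gamma>3 P1 Q1 P2 Q2 P3 Q3 where \<gamma>:
    "smooth_curve_with_ends \<gamma>1 P1 Q1" "smooth_curve_with_ends \<gamma>2 P2 Q2"
    "smooth_curve_with_ends \<gamma>3 P3 Q3"
    "{#P1, Q1, P2, Q2, P3, Q3#} =
      {#shape (s m) \<kappa> 1 0 0, shape (s m) \<kappa> 0 1 0, shape (s m) \<kappa> 0 0 1,
        shape (s m) \<kappa> 0 1 1, shape (s m) \<kappa> 1 0 1, shape (s m) \<kappa> 1 1 0#}"
    "balanced_configurations (s m) \<kappa> = \<gamma>1 ` {0<..<1} \<union> \<gamma>2 ` {0<..<1} \<union> \<gamma>3 ` {0<..<1}"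
    using curves unfolding three_balanced_curves_def by (elim exE conjE) (rule that)
  have "{#s P1, s Q1, s P2, s Q2, s P3, s Q3#} =
      {#shape m \<kappa> 1 0 0, shape m \<kappa> 0 1 0, shape m \<kappa> 0 0 1,
        shape m \<kappa> 0 1 1, shape m \<kappa> 1 0 1, shape m \<kappa> 1 1 0#}"
    using arg_cong[OF \<gamma>(4), of "image_mset s"] ends by simp
  moreover have "balanced_configurations m \<kappa> =
      (\<lambda>t. s (\<gamma>1 t)) ` {0<..<1} \<union> (\<lambda>t. s (\<gamma>2 t)) ` {0<..<1} \<union> (\<lambda>t. s (\<gamma>3 t)) ` {0<..<1}"
  proof -
    have "balanced_configurations m \<kappa> = s ` balanced_configurations (s m) \<kappa>"
      unfolding balanced image_image by (simp add: s(2))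
    then show ?thesis unfolding \<gamma>(5) by (simp add: image_Un image_image)
  qed
  ultimately show ?thesis
    unfolding three_balanced_curves_def using curve[OF \<gamma>(1)] curve[OF \<gamma>(2)] curve[OF \<gamma>(3)]
    by (intro exI conjI)
qed

definition swap12 :: "real^3 \<Rightarrow> real^3" where "swap12 p = vector [p$2, p$1, p$3]"
definition swap23 :: "real^3 \<Rightarrow> real^3" where "swap23 p = vector [p$1, p$3, p$2]"

lemma swap_nth:
  "swap12 p $ 1 = p$2" "swap12 p $ 2 = p$1" "swap12 p $ 3 = p$3"
  "swap23 p $ 1 = p$1" "swap23 p $ 2 = p$3" "swap23 p $ 3 = p$2"
  by (simp_all add: swap12_def swap23_def)

lemma swap_swap: "swap12 (swap12 p) = p" "swap23 (swap23 p) = p"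
  by (simp_all add: vec_eq_iff forall_3 swap_nth)

lemma bounded_linear_swap: "bounded_linear swap12" "bounded_linear swap23"
  unfolding linear_conv_bounded_linear[symmetric]
  by (rule linearI; simp add: vec_eq_iff forall_3 swap_nth)+

lemma det_balance_matrix_swap:
  "det (balance_matrix (swap12 m) (swap12 p)) = - det (balance_matrix m p)"
  "det (balance_matrix (swap23 m) (swap23 p)) = - det (balance_matrix m p)"
  by (simp_all add: balance_matrix_def det_3 Let_def swap_nth algebra_simps)

lemma inertia_swap: "inertia (swap12 m) (swap12 p) = inertia m p"
  "inertia (swap23 m) (swap23 p) = inertia m p"
  by (simp_all add: inertia_def swap_nth ac_simps)

lemma balanced_configurations_swap:
  "balanced_configurations (swap12 m) \<kappa> = swap12 ` balanced_configurations m \<kappa>"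
  "balanced_configurations (swap23 m) \<kappa> = swap23 ` balanced_configurations m \<kappa>"
proof -
  have "p \<in> balanced_configurations (swap12 m) \<kappa> \<longleftrightarrow> swap12 p \<in> balanced_configurations m \<kappa>"
    "p \<in> balanced_configurations (swap23 m) \<kappa> \<longleftrightarrow> swap23 p \<in> balanced_configurations m \<kappa>" for p
    using det_balance_matrix_swap[of m "swap12 p"] det_balance_matrix_swap[of m "swap23 p"]
      inertia_swap[of m "swap12 p"] inertia_swap[of m "swap23 p"]
    by (auto simp: balanced_configurations_def shape_triangle_def swap_swap swap_nth)
  then show "balanced_configurations (swap12 m) \<kappa> = swap12 ` balanced_configurations m \<kappa>"
    "balanced_configurations (swap23 m) \<kappa> = swap23 ` balanced_configurations m \<kappa>"
    using swap_swap by (auto simp: image_iff) metis+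
qed

lemma shape_swap:
  "swap12 (shape (swap12 m) \<kappa> a b c) = shape m \<kappa> b a c"
  "swap23 (shape (swap23 m) \<kappa> a b c) = shape m \<kappa> a c b"
  by (simp_all add: vec_eq_iff forall_3 swap_nth shape_nth inertia_vector ac_simps)

lemma three_balanced_curves_swap12:
  "three_balanced_curves (swap12 m) \<kappa> \<Longrightarrow> three_balanced_curves m \<kappa>"
  by (rule three_balanced_curves_of_involution[OF bounded_linear_swap(1) swap_swap(1) _ balanced_configurations_swap(1)])
    (simp_all add: shape_swap add_mset_commute)

lemma three_balanced_curves_swap23:
  "three_balanced_curves (swap23 m) \<kappa> \<Longrightarrow> three_balanced_curves m \<kappa>"
  by (rule three_balanced_curves_of_involution[OF bounded_linear_swap(2) swap_swap(2) _ balanced_configurations_swap(2)])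
    (simp_all add: shape_swap add_mset_commute)

section \<open>Limits of roots\<close>

lemma eventually_sign_near:
  fixes f :: "real \<Rightarrow> real"
  assumes "isCont f a" "s * f a > 0"
  shows "\<forall>\<^sub>F w in at a within A. s * f w > 0"
proof -
  have "((\<lambda>w. s * f w) \<longlongrightarrow> s * f a) (at a within A)"
    using assms(1) by (intro tendsto_intros) (simp add: continuous_at_imp_continuous_within flip: continuous_within)
  then show ?thesis using assms(2) by (rule order_tendstoD)
qed

text \<open>
  Along the ray of slope \<open>u\<close>, the shape \<open>(w, u * w, 1)\<close> is \<open>w\<close> times \<open>(1, u, 1 / w)\<close>, which tends to a
  point on the side where the third distance is zero.
\<close>

lemma eventually_sign_at_top:
  assumes "s * balance_poly m 1 u 0 > 0"
  shows "\<forall>\<^sub>F w in at_top. s * balance_poly m w (u * w) 1 > 0"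
proof -
  have "((\<lambda>w. s * balance_poly m 1 u (inverse w)) \<longlongrightarrow> s * balance_poly m 1 u 0) at_top"
    using isCont_tendsto_compose[OF isCont_balance_poly_last tendsto_inverse_0_at_top[OF filterlim_ident]]
    by (intro tendsto_intros)
  then have "\<forall>\<^sub>F w in at_top. s * balance_poly m 1 u (inverse w) > 0"
    using assms by (rule order_tendstoD)
  moreover have "\<forall>\<^sub>F w in at_top. w > (0::real)" by (rule eventually_gt_at_top)
  ultimately show ?thesis
  proof eventually_elim
    case (elim w)
    have "balance_poly m w (u * w) 1 = w ^ 8 * balance_poly m 1 u (inverse w)"
      using balance_poly_scale[of m w 1 u "inverse w"] elim(2) by (simp add: mult.commute)
    then have "s * balance_poly m w (u * w) 1 = w ^ 8 * (s * balance_poly m 1 u (inverse w))"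
      by (simp only: mult.left_commute)
    moreover have "w ^ 8 * (s * balance_poly m 1 u (inverse w)) > 0"
      using mult_pos_pos[OF zero_less_power[OF elim(2), of 8] elim(1)] .
    ultimately show ?case by (simp only:)
  qed
qed

text \<open>
  For a limit it suffices to consider bounds that are close to it, where the signs are known.
\<close>

lemma tendsto_nearby_boundsI:
  fixes f :: "'a \<Rightarrow> real"
  assumes "a < l" "l < b"
    and "\<And>u v. a < u \<Longrightarrow> u < l \<Longrightarrow> l < v \<Longrightarrow> v < b \<Longrightarrow> \<forall>\<^sub>F w in F. u < f w \<and> f w < v"
  shows "(f \<longlongrightarrow> l) F"
proof (rule order_tendstoI)
  fix c assume "c < l"
  with assms(1) have "max c ((a + l) / 2) < l" "a < max c ((a + l) / 2)"
    by (auto simp: less_max_iff_disj)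
  then have "\<forall>\<^sub>F w in F. max c ((a + l) / 2) < f w \<and> f w < (l + b) / 2"
    using assms by (intro assms(3)) auto
  then show "\<forall>\<^sub>F w in F. c < f w" by (auto elim: eventually_mono)
next
  fix c assume "l < c"
  with assms(2) have "l < min c ((l + b) / 2)" "min c ((l + b) / 2) < b" by (auto simp: min_def)
  then have "\<forall>\<^sub>F w in F. (a + l) / 2 < f w \<and> f w < min c ((l + b) / 2)"
    using assms by (intro assms(3)) auto
  then show "\<forall>\<^sub>F w in F. f w < c" by (auto elim: eventually_mono)
qed

lemma cube_less_one_iff: "w \<ge> 0 \<Longrightarrow> w^3 < (1::real) \<longleftrightarrow> w < 1"
  and one_less_cube_iff: "w \<ge> 0 \<Longrightarrow> 1 < w^3 \<longleftrightarrow> (1::real) < w"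
  using power_less_imp_less_base[of w 3 1] power_strict_mono[of w 1 3]
    power_less_imp_less_base[of 1 3 w] power_strict_mono[of 1 w 3] by auto

section \<open>The three types of mass ratios\<close>

lemma three_balanced_curves_equal_masses:
  assumes m: "m$1 > 0" "m$2 = m$1" "m$3 = m$1" and \<kappa>: "\<kappa> > 0"
  shows "three_balanced_curves m \<kappa>"
proof -
  have m': "m$1 > 0" "m$2 > 0" "m$3 > 0" using m by auto
  have par: "interval_param {0<..} (at_right 0) at_top (\<lambda>t. 0 + t / (1 - t))"
    by (rule interval_param_halfline)
  have S: "open {0::real<..}" by simp
  have c1: "\<exists>\<gamma>. smooth_curve_with_ends \<gamma> (shape m \<kappa> (0\<^sup>2) (1\<^sup>2) 1) (shape m \<kappa> 1 (0\<^sup>2) 0) \<and>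
      \<gamma> ` {0<..<1} = (\<lambda>w. shape m \<kappa> (w\<^sup>2) (1\<^sup>2) 1) ` {0<..}"
  proof (rule smooth_curve_of_plane_curve[OF m' \<kappa> S par])
    show "((\<lambda>w. shape m \<kappa> (w\<^sup>2) (1\<^sup>2) 1) \<longlongrightarrow> shape m \<kappa> (0\<^sup>2) (1\<^sup>2) 1) (at_right 0)"
      by (intro shape_end_finite m' id_at_right_0 tendsto_const)
    show "((\<lambda>w. shape m \<kappa> (w\<^sup>2) (1\<^sup>2) 1) \<longlongrightarrow> shape m \<kappa> 1 (0\<^sup>2) 0) at_top"
      using tendsto_inverse_0_at_top[OF filterlim_ident]
      by (intro shape_end_x_infinite m' filterlim_ident) (simp add: inverse_eq_divide)
  qed (auto intro: C_infinity_ident_pos C_infinity_one_pos)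
  have c2: "\<exists>\<gamma>. smooth_curve_with_ends \<gamma> (shape m \<kappa> (1\<^sup>2) (0\<^sup>2) 1) (shape m \<kappa> 0 1 0) \<and>
      \<gamma> ` {0<..<1} = (\<lambda>w. shape m \<kappa> (1\<^sup>2) (w\<^sup>2) 1) ` {0<..}"
  proof (rule smooth_curve_of_plane_curve[OF m' \<kappa> S par])
    show "((\<lambda>w. shape m \<kappa> (1\<^sup>2) (w\<^sup>2) 1) \<longlongrightarrow> shape m \<kappa> (1\<^sup>2) (0\<^sup>2) 1) (at_right 0)"
      by (intro shape_end_finite m' id_at_right_0 tendsto_const)
    show "((\<lambda>w. shape m \<kappa> (1\<^sup>2) (w\<^sup>2) 1) \<longlongrightarrow> shape m \<kappa> 0 1 0) at_top"
      by (intro shape_end_y_infinite[OF m' tendsto_const] filterlim_ident)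
  qed (auto intro: C_infinity_ident_pos C_infinity_one_pos)
  have c3: "\<exists>\<gamma>. smooth_curve_with_ends \<gamma> (shape m \<kappa> (0\<^sup>2) (0\<^sup>2) 1) (shape m \<kappa> 1 (1\<^sup>2) 0) \<and>
      \<gamma> ` {0<..<1} = (\<lambda>w. shape m \<kappa> (w\<^sup>2) (w\<^sup>2) 1) ` {0<..}"
  proof (rule smooth_curve_of_plane_curve[OF m' \<kappa> S par])
    show "((\<lambda>w. shape m \<kappa> (w\<^sup>2) (w\<^sup>2) 1) \<longlongrightarrow> shape m \<kappa> (0\<^sup>2) (0\<^sup>2) 1) (at_right 0)"
      by (intro shape_end_finite m' id_at_right_0)
    have "\<forall>\<^sub>F w in at_top. w / w = (1::real)"
      using eventually_gt_at_top[of 0] by eventually_elim simp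
    then show "((\<lambda>w. shape m \<kappa> (w\<^sup>2) (w\<^sup>2) 1) \<longlongrightarrow> shape m \<kappa> 1 (1\<^sup>2) 0) at_top"
      by (intro shape_end_x_infinite m' filterlim_ident tendsto_eventually)
  qed (auto intro: C_infinity_ident_pos)
  have zeros: "balance_poly m w z 1 = 0 \<longleftrightarrow> w = 1 \<or> z = 1 \<or> w = z" if "w > 0" "z > 0" for w z
  proof -
    \<comment> \<open>The quotient of the polynomial by its three linear factors, up to a constant.\<close>
    define s where "s = (1 + w + w\<^sup>2) * (z^3 + (1 + w) * z\<^sup>2) + w * (1 + w)\<^sup>2 * z + w\<^sup>2 * (1 + w)"
    have "balance_poly m w z 1 = 2 * m$1 * (1 - w) * (z - 1) * (z - w) * s"
      unfolding balance_poly_def m s_def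
      by (simp add: algebra_simps power2_eq_square power3_eq_cube)
    moreover have "s > 0" unfolding s_def using that by (intro add_pos_pos mult_pos_pos) auto
    ultimately show ?thesis using m by auto
  qed
  show ?thesis
  proof (rule three_balanced_curvesI[OF m' \<kappa> c1 c2 c3])
    show "{#shape m \<kappa> (0\<^sup>2) (1\<^sup>2) 1, shape m \<kappa> 1 (0\<^sup>2) 0, shape m \<kappa> (1\<^sup>2) (0\<^sup>2) 1, shape m \<kappa> 0 1 0,
        shape m \<kappa> (0\<^sup>2) (0\<^sup>2) 1, shape m \<kappa> 1 (1\<^sup>2) 0#} =
      {#shape m \<kappa> 1 0 0, shape m \<kappa> 0 1 0, shape m \<kappa> 0 0 1,
        shape m \<kappa> 0 1 1, shape m \<kappa> 1 0 1, shape m \<kappa> 1 1 0#}"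
      by (simp add: add_mset_commute)
    show "(w > 0 \<and> z > 0 \<and> balance_poly m w z 1 = 0) \<longleftrightarrow>
      (w, z) \<in> (\<lambda>w. (w, 1)) ` {0<..} \<union> (\<lambda>w. (1, w)) ` {0<..} \<union> (\<lambda>w. (w, w)) ` {0<..}" for w z
      using zeros[of w z] by (auto simp: image_graph_iff)
  qed
qed

text \<open>
  The inequality \<open>m\<^sub>2 > m\<^sub>3\<close> gives the value at \<open>z = 1\<close>, the isosceles shapes, its sign: negative for
  \<open>w < 1\<close> and positive for \<open>w > 1\<close>, opposite to that of \<open>Q\<close>. So \<open>z = 1\<close> separates the decreasing from
  the increasing root. For \<open>w > 1\<close> both \<open>L\<close> and \<open>Q\<close> are negative and both roots exist. For \<open>w < 1\<close>
  there are both roots as long as \<open>L > 0\<close>, and only the decreasing one if \<open>L \<le> 0\<close>. At \<open>w = 1\<close> the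
  only root is the equilateral shape \<open>z = 1\<close>, and the decreasing root passes through it from below
  to above 1. Limits are found by trapping the root between two points of opposite sign.
\<close>

lemma three_balanced_curves_lightest_unique:
  assumes m: "m$1 > 0" "m$2 > 0" "m$3 > 0" and order: "m$1 \<ge> m$2" "m$2 > m$3" and \<kappa>: "\<kappa> > 0"
  shows "three_balanced_curves m \<kappa>"
proof -
  define L K P Q where
    "L w = (m$2 + m$3) - (m$1 + m$2) * w^3" and
    "K w = - m$1 * w^3 * (1 - w\<^sup>2) + m$2 * (1 + w\<^sup>2) * (w^3 - 1) + m$3 * (w\<^sup>2 - 1)" and
    "P w = (m$1 - m$3) * w^3" and
    "Q w = (m$1 + m$3) * (1 - w\<^sup>2) * w^3" for w
  define F where "F w = quintic (L w) (K w) (P w) (Q w)" for w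
  define F' where "F' w = quintic_deriv (L w) (K w) (P w)" for w
  have F: "F w z = balance_poly m w z 1" for w z
    unfolding F_def quintic_def balance_poly_def L_def K_def P_def Q_def
    by (simp add: algebra_simps power2_eq_square power3_eq_cube eval_nat_numeral)
  have smooth: "C_infinity_on S L" "C_infinity_on S K" "C_infinity_on S P" "C_infinity_on S Q"
    if "open S" for S
    unfolding L_def[abs_def] K_def[abs_def] P_def[abs_def] Q_def[abs_def]
    by (intro C_infinity_intros that)+
  \<comment> \<open>Signs of the coefficients and of the value at \<open>z = 1\<close>.\<close>
  have F1: "F w 1 = (m$2 - m$3) * w\<^sup>2 * (w^3 - 1)" for w
    by (simp add: F balance_poly_isosceles)
  have F1_neg: "F w 1 < 0" if "0 < w" "w < 1" for w
    using that order cube_less_one_iff[of w] by (auto simp: F1 mult_less_0_iff)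
  have F1_pos: "F w 1 > 0" if "w > 1" for w
    using that order one_less_cube_iff[of w] by (auto simp: F1)
  have Ppos: "P w > 0" if "w > 0" for w using that order by (simp add: P_def)
  have Qpos: "Q w > 0" if "0 < w" "w < 1" for w
    using that m by (auto simp: Q_def power_strict_mono[of w 1 2, simplified] intro!: mult_pos_pos)
  have Qneg: "Q w < 0" if "w > 1" for w
    using that m power_strict_mono[of 1 w 2] by (auto simp: Q_def mult_less_0_iff)
  have Lneg: "L w < 0" if "w > 1" for w
  proof -
    have "(m$1 + m$2) * 1 < (m$1 + m$2) * w^3"
      using that m one_less_cube_iff[of w] by (intro mult_strict_left_mono) auto
    then show ?thesis using order by (simp add: L_def)
  qed
  have at_1: "F 1 z = (m$1 - m$3) * z\<^sup>2 * (1 - z^3)" "F' 1 1 = - 3 * (m$1 - m$3)" for z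
    unfolding F_def F'_def quintic_def quintic_deriv_def L_def K_def P_def Q_def
    by (simp_all add: algebra_simps flip: power_add)
  have root_at_1: "z = 1" if "F 1 z = 0" "z > 0" for z
    using that order at_1(1)[of z] cube_less_one_iff[of z] one_less_cube_iff[of z]
    by (cases z "1::real" rule: linorder_cases) auto
  \<comment> \<open>For \<open>w < 1\<close> the decreasing roots are those below 1 and the increasing ones those above; for
    \<open>w > 1\<close> it is the other way round. So any root trapped on one side of 1 is identified.\<close>
  have sign_below: "z \<noteq> 1 \<and> F' w z * (z - 1) > 0" if "0 < w" "w < 1" "z > 0" "F w z = 0" for w z
  proof (cases "L w \<ge> 0")
    case True
    have "z \<noteq> 1" using F1_neg that by force
    moreover have "1 * F' w z * (1 - z) < 0"
      unfolding F'_def using that True Qpos[OF that(1,2)] F1_neg[OF that(1,2)] \<open>z \<noteq> 1\<close>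
      by (intro quintic_above_tangent[of 1 "L w" "Q w" 1 z]) (auto simp: F_def)
    ultimately show ?thesis by (simp add: algebra_simps)
  next
    case False
    have "F' w z < 0"
      unfolding F'_def using that False Qpos[OF that(1,2)] Ppos[OF that(1)]
      by (intro quintic_deriv_neg_at_root[of "L w" "P w" "Q w"]) (auto simp: F_def)
    moreover have "z < 1"
    proof (rule ccontr)
      assume "\<not> z < 1"
      then have "z = 1 \<or> 1 < z" by linarith
      then show False
        using quintic_decreasing_ratio[of "L w" "P w" "Q w" 1 z "K w"] that False
          Qpos[OF that(1,2)] Ppos[OF that(1)] F1_neg[OF that(1,2)]
        by (auto simp: F_def zero_less_mult_iff)
    qed
    ultimately show ?thesis by (simp add: mult_neg_neg)
  qed
  have sign_above: "z \<noteq> 1 \<and> F' w z * (z - 1) < 0" if "w > 1" "z > 0" "F w z = 0" for w z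
  proof -
    have "z \<noteq> 1" using F1_pos that by force
    moreover have "- 1 * F' w z * (1 - z) < 0"
      unfolding F'_def using that Lneg[OF that(1)] Qneg[OF that(1)] F1_pos[OF that(1)] \<open>z \<noteq> 1\<close>
      by (intro quintic_above_tangent[of "-1" "L w" "Q w" 1 z]) (auto simp: F_def)
    ultimately show ?thesis by (simp add: algebra_simps)
  qed
  have same: "u = v" if "w > 0" "u > 0" "v > 0" "F w u = 0" "F w v = 0"
    "\<sigma> * F' w u > 0" "\<sigma> * F' w v > 0" for w u v \<sigma>
  proof -
    consider "w < 1" "L w \<ge> 0" | "w < 1" "L w < 0" | "w = 1" | "w > 1" by linarith
    then show ?thesis
    proof cases
      case 1
      then show ?thesis
        using quintic_root_unique[of 1 "L w" "Q w" u v "K w" "P w" \<sigma>] that Qpos[of w]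
        by (auto simp: F_def F'_def)
    next
      case 2
      then show ?thesis
        using quintic_decreasing_ratio[of "L w" "P w" "Q w" u v "K w"]
          quintic_decreasing_ratio[of "L w" "P w" "Q w" v u "K w"] that Qpos[of w] Ppos[of w]
        by (cases u v rule: linorder_cases) (auto simp: F_def)
    next
      case 3
      then show ?thesis using root_at_1 that by auto
    next
      case 4
      then show ?thesis
        using quintic_root_unique[of "-1" "L w" "Q w" u v "K w" "P w" \<sigma>] that Qneg[of w] Lneg[of w]
        by (auto simp: F_def F'_def)
    qed
  qed
  have between: "\<exists>z. u < z \<and> z < v \<and> F w z = 0" if "u < v" "F w u * F w v < 0" for w u v
    using that root_between[of u v "F w"] continuous_on_quintic unfolding F_def by blast
  have F0: "F w 0 = Q w" for w by (simp add: F_def quintic_def)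
  have neg_ex: "\<exists>z>0. F w z = 0 \<and> - 1 * F' w z > 0" if w: "w > 0" for w
  proof -
    consider "w < 1" | "w = 1" | "w > 1" by linarith
    then show ?thesis
    proof cases
      case 1
      then obtain z where "0 < z" "z < 1" "F w z = 0"
        using between[of 0 1 w] Qpos[of w] F1_neg[of w] w by (auto simp: F0 mult_less_0_iff)
      then show ?thesis using sign_below[of w z] 1 w by (auto simp: zero_less_mult_iff)
    next
      case 2
      then show ?thesis using at_1 order by (intro exI[of _ 1]) auto
    next
      case 3
      obtain N where "N > 1" "- 1 * F w N > 0"
        using quintic_sign_at_infinity[of "-1" "L w" 1 "K w" "P w" "Q w"] Lneg[OF 3]
        by (auto simp: F_def)
      then obtain z where "1 < z" "F w z = 0"
        using between[of 1 N w] F1_pos[OF 3] by (auto simp: mult_less_0_iff)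
      then show ?thesis using sign_above[of w z] 3 by (intro exI[of _ z]) (auto simp: mult_less_0_iff)
    qed
  qed
  \<comment> \<open>The zero of \<open>L\<close>, where the increasing root goes to infinity.\<close>
  define r where "r = root 3 ((m$2 + m$3) / (m$1 + m$2))"
  have r3: "r^3 = (m$2 + m$3) / (m$1 + m$2)" unfolding r_def by (rule odd_real_root_pow) simp
  have r: "r > 0" "r < 1"
  proof -
    show "r > 0" unfolding r_def using m by (simp add: real_root_gt_zero)
    have "r^3 < 1" unfolding r3 using m order by (simp add: field_simps)
    then show "r < 1" using cube_less_one_iff[of r] \<open>r > 0\<close> by simp
  qed
  have L_r: "L w = (m$1 + m$2) * (r^3 - w^3)" for w
    using m by (simp add: L_def r3 field_simps)
  have Lpos_iff: "L w > 0 \<longleftrightarrow> w < r" if "w > 0" for w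
  proof -
    have "w^3 < r^3 \<longleftrightarrow> w < r" 
      using that r power_less_imp_less_base[of w 3 r] power_strict_mono[of w r 3] by auto
    then show ?thesis using m by (auto simp: L_r zero_less_mult_iff)
  qed
  have pos_ex_below: "\<exists>z>0. F w z = 0 \<and> 1 * F' w z > 0" if w: "0 < w" "w < r" for w
  proof -
    obtain N where "N > 1" "F w N > 0"
      using quintic_sign_at_infinity[of 1 "L w" 1 "K w" "P w" "Q w"] Lpos_iff w by (auto simp: F_def)
    then obtain z where "1 < z" "F w z = 0"
      using between[of 1 N w] F1_neg[of w] w r by (auto simp: mult_less_0_iff)
    then show ?thesis using sign_below[of w z] w r by (intro exI[of _ z]) (auto simp: zero_less_mult_iff)
  qed
  have pos_ex_above: "\<exists>z>0. F w z = 0 \<and> 1 * F' w z > 0" if w: "w > 1" for w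
  proof -
    obtain z where "0 < z" "z < 1" "F w z = 0"
      using between[of 0 1 w] Qneg[of w] F1_pos[of w] w by (auto simp: F0 mult_less_0_iff)
    then show ?thesis using sign_above[of w z] w by (intro exI[of _ z]) (auto simp: mult_less_0_iff)
  qed
  obtain g1 where g1: "C_infinity_on {0<..} g1" "\<And>w. w \<in> {0<..} \<Longrightarrow> g1 w > 0"
    "\<And>w z. w \<in> {0<..} \<Longrightarrow> z > 0 \<Longrightarrow> z = g1 w \<longleftrightarrow> F w z = 0 \<and> - 1 * F' w z > 0"
    unfolding F_def F'_def
    by (rule smooth_quintic_branch[of "{0<..}" L K P Q "-1"])
      (use smooth neg_ex same[of _ _ _ "-1"] in \<open>auto simp: F_def F'_def\<close>)
  obtain g2 where g2: "C_infinity_on {0<..<r} g2" "\<And>w. w \<in> {0<..<r} \<Longrightarrow> g2 w > 0"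
    "\<And>w z. w \<in> {0<..<r} \<Longrightarrow> z > 0 \<Longrightarrow> z = g2 w \<longleftrightarrow> F w z = 0 \<and> 1 * F' w z > 0"
    unfolding F_def F'_def
    by (rule smooth_quintic_branch[of "{0<..<r}" L K P Q 1])
      (use smooth pos_ex_below same[of _ _ _ 1] in \<open>auto simp: F_def F'_def\<close>)
  obtain g3 where g3: "C_infinity_on {1<..} g3" "\<And>w. w \<in> {1<..} \<Longrightarrow> g3 w > 0"
    "\<And>w z. w \<in> {1<..} \<Longrightarrow> z > 0 \<Longrightarrow> z = g3 w \<longleftrightarrow> F w z = 0 \<and> 1 * F' w z > 0"
    unfolding F_def F'_def
    by (rule smooth_quintic_branch[of "{1<..}" L K P Q 1])
      (use smooth pos_ex_above same[of _ _ _ 1, OF less_trans[OF zero_less_one]] in \<open>auto simp: F_def F'_def\<close>)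
  have g1_root: "F w (g1 w) = 0" "F' w (g1 w) < 0" if "w > 0" for w
    using g1(3)[of w "g1 w"] g1(2)[of w] that by auto
  have g2_root: "F w (g2 w) = 0" "F' w (g2 w) > 0" if "0 < w" "w < r" for w
    using g2(3)[of w "g2 w"] g2(2)[of w] that by auto
  have g3_root: "F w (g3 w) = 0" "F' w (g3 w) > 0" if "w > 1" for w
    using g3(3)[of w "g3 w"] g3(2)[of w] that by auto
  have near: "\<forall>\<^sub>F w in at a within A. s * F w z > 0" if "s * F a z > 0" for s a z A
    using eventually_sign_near[of a "\<lambda>w. F w z" s A] isCont_balance_poly[of a m z] that
    unfolding F by blast
  have far: "\<forall>\<^sub>F w in at_top. s * F w (u * w) > 0" if "s * ((m$1 + m$2) * u^3 * (1 - u\<^sup>2)) > 0" for s u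
    unfolding F using that by (intro eventually_sign_at_top) (simp add: balance_poly_infinity)
  have F_0: "F 0 z = (m$2 + m$3) * z^3 * (z\<^sup>2 - 1)" for z
    by (simp add: F balance_poly_0)
  have right_0: "\<forall>\<^sub>F w in at_right 0. 0 < w \<and> w < c" if "c > 0" for c :: real
    unfolding eventually_at_right_field using that by (intro exI[of _ c]) auto
  \<comment> \<open>The six ends. The signs near \<open>w = 0\<close> are those of \<open>z\<^sup>2 - 1\<close>, and for large \<open>w\<close> those of
    \<open>1 - (z / w)\<^sup>2\<close>: so 0 and 1 are the only possible limits of \<open>z\<close> and of \<open>z / w\<close> there.\<close>
  have g1_0: "(g1 \<longlongrightarrow> 0) (at_right 0)"
  proof (rule order_tendstoI)
    fix c :: real
    assume "c < 0"
    show "\<forall>\<^sub>F w in at_right 0. c < g1 w"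
      using right_0[OF zero_less_one] by eventually_elim (use g1(2) \<open>c < 0\<close> in force)+
  next
    fix c :: real
    assume "0 < c"
    define e where "e = min c (1/2)"
    have e: "0 < e" "e < 1" "e \<le> c" using \<open>0 < c\<close> by (auto simp: e_def)
    have "- 1 * F 0 e > 0"
      using e m power_strict_mono[of e 1 2] by (auto simp: F_0 mult_less_0_iff)
    then have "\<forall>\<^sub>F w in at_right 0. - 1 * F w e > 0" by (rule near)
    then show "\<forall>\<^sub>F w in at_right 0. g1 w < c"
      using right_0[OF zero_less_one]
    proof eventually_elim
      case (elim w)
      then obtain z where z: "0 < z" "z < e" "F w z = 0"
        using between[of 0 e w] e Qpos[of w] by (auto simp: F0 mult_less_0_iff)
      then have "z = g1 w"
        using g1(3)[of w z] sign_below[of w z] elim e by (auto simp: zero_less_mult_iff)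
      then show ?case using z e by simp
    qed
  qed
  have g1_inf: "((\<lambda>w. g1 w / w) \<longlongrightarrow> 1) at_top"
  proof (rule tendsto_nearby_boundsI[of 0 1 2])
    fix u v :: real
    assume uv: "0 < u" "u < 1" "1 < v" "v < 2"
    have u: "1 * ((m$1 + m$2) * u^3 * (1 - u\<^sup>2)) > 0"
      using uv m power_strict_mono[of u 1 2] by auto
    have v: "- 1 * ((m$1 + m$2) * v^3 * (1 - v\<^sup>2)) > 0"
      using uv m power_strict_mono[of 1 v 2] by (auto simp: mult_less_0_iff)
    from far[OF u] far[OF v]
    show "\<forall>\<^sub>F w in at_top. u < g1 w / w \<and> g1 w / w < v"
      using eventually_gt_at_top[of "1 / u"]
    proof eventually_elim
      case (elim w)
      have w: "w > 1" "u * w > 1"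
      proof -
        show "u * w > 1" using elim(3) uv by (simp add: field_simps)
        have "1 / u > 1" using uv by simp
        then show "w > 1" using elim(3) by linarith
      qed
      then obtain z where z: "u * w < z" "z < v * w" "F w z = 0"
        using between[of "u * w" "v * w" w] elim uv by (auto simp: mult_less_0_iff)
      then have "z = g1 w"
        using g1(3)[of w z] sign_above[of w z] w by (auto simp: mult_less_0_iff)
      then show ?case using z w by (simp add: field_simps)
    qed
  qed simp_all
  have g2_0: "(g2 \<longlongrightarrow> 1) (at_right 0)"
  proof (rule tendsto_nearby_boundsI[of 0 1 2])
    fix u v :: real
    assume uv: "0 < u" "u < 1" "1 < v" "v < 2"
    have "1 * F 0 v > 0" using uv m power_strict_mono[of 1 v 2] by (auto simp: F_0)
    then have "\<forall>\<^sub>F w in at_right 0. 1 * F w v > 0" by (rule near)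
    then show "\<forall>\<^sub>F w in at_right 0. u < g2 w \<and> g2 w < v"
      using right_0[OF r(1)]
    proof eventually_elim
      case (elim w)
      then obtain z where z: "1 < z" "z < v" "F w z = 0"
        using between[of 1 v w] uv r F1_neg[of w] by (auto simp: mult_less_0_iff)
      then have "z = g2 w"
        using g2(3)[of w z] sign_below[of w z] elim r by (auto simp: zero_less_mult_iff)
      then show ?case using z uv by simp
    qed
  qed simp_all
  have g2_r: "filterlim g2 at_top (at_left r)"
    unfolding filterlim_at_top_gt[where c = 1]
  proof (intro allI impI)
    fix Z :: real
    assume Z: "Z > 1"
    \<comment> \<open>At \<open>w = r\<close> the degree drops to 3, and the comparison with \<open>Z^3 * F r 1 < 0\<close> shows that the
      cubic is negative at every \<open>Z > 1\<close>. So for \<open>w\<close> near \<open>r\<close> the increasing root lies beyond \<open>Z\<close>.\<close>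
    have "Z^3 * F r 1 - F r Z = P r * (Z\<^sup>2 * (Z - 1)) + Q r * (Z^3 - 1)"
      using L_r[of r] by (simp add: F_def quintic_def algebra_simps power2_eq_square power3_eq_cube)
    moreover have "P r * (Z\<^sup>2 * (Z - 1)) > 0" "Q r * (Z^3 - 1) > 0"
      using Z Ppos[of r] Qpos[of r] r one_less_cube_iff[of Z] by auto
    moreover have "Z^3 * F r 1 < 0" using Z F1_neg[OF r] by (simp add: mult_less_0_iff)
    ultimately have "- 1 * F r Z > 0" by linarith
    then have "\<forall>\<^sub>F w in at_left r. - 1 * F w Z > 0" by (rule near)
    moreover have "\<forall>\<^sub>F w in at_left r. 0 < w \<and> w < r"
      unfolding eventually_at_left_field using r by (intro exI[of _ 0]) auto
    ultimately show "\<forall>\<^sub>F w in at_left r. Z \<le> g2 w"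
    proof eventually_elim
      case (elim w)
      obtain N where "N > Z" "F w N > 0"
        using quintic_sign_at_infinity[of 1 "L w" Z "K w" "P w" "Q w"] Lpos_iff elim by (auto simp: F_def)
      then obtain z where z: "Z < z" "F w z = 0"
        using between[of Z N w] elim by (auto simp: mult_less_0_iff)
      then have "z = g2 w"
        using g2(3)[of w z] sign_below[of w z] elim r Z by (auto simp: zero_less_mult_iff)
      then show ?case using z by simp
    qed
  qed
  have g3_1: "(g3 \<longlongrightarrow> 0) (at_right 1)"
  proof (rule order_tendstoI)
    have right_1: "\<forall>\<^sub>F w in at_right 1. (1::real) < w" by (simp add: eventually_at_right_less)
    {
      fix c :: real
      assume "c < 0"
      show "\<forall>\<^sub>F w in at_right 1. c < g3 w"
        using right_1 by eventually_elim (use g3(2) \<open>c < 0\<close> in force)+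
    next
      fix c :: real
      assume "0 < c"
      define e where "e = min c (1/2)"
      have e: "0 < e" "e < 1" "e \<le> c" using \<open>0 < c\<close> by (auto simp: e_def)
      have "1 * F 1 e > 0" using e order cube_less_one_iff[of e] by (auto simp: at_1)
      then have "\<forall>\<^sub>F w in at_right 1. 1 * F w e > 0" by (rule near)
      then show "\<forall>\<^sub>F w in at_right 1. g3 w < c"
        using right_1
      proof eventually_elim
        case (elim w)
        then obtain z where z: "0 < z" "z < e" "F w z = 0"
          using between[of 0 e w] e Qneg[of w] by (auto simp: F0 mult_less_0_iff)
        then have "z = g3 w"
          using g3(3)[of w z] sign_above[of w z] elim e by (auto simp: mult_less_0_iff)
        then show ?case using z e by simp
      qed
    }
  qed
  have g3_less: "g3 w < 1" if "w > 1" for w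
    using sign_above[of w "g3 w"] g3_root[OF that] g3(2)[of w] that by (auto simp: mult_less_0_iff)
  have g3_inf: "((\<lambda>w. g3 w / w) \<longlongrightarrow> 0) at_top"
  proof (rule tendsto_sandwich)
    show "\<forall>\<^sub>F w in at_top. 0 \<le> g3 w / w"
      using eventually_gt_at_top[of 1] by eventually_elim (simp add: g3(2) less_imp_le)
    show "\<forall>\<^sub>F w in at_top. g3 w / w \<le> inverse w"
      using eventually_gt_at_top[of 1]
      by eventually_elim (simp add: g3_less less_imp_le inverse_eq_divide divide_right_mono)
  qed (auto intro: tendsto_inverse_0_at_top filterlim_ident)
  have ident: "C_infinity_on S (\<lambda>w. w)" if "open S" for S :: "real set"
    using that by (rule C_infinity_on_ident)
  have c1: "\<exists>\<gamma>. smooth_curve_with_ends \<gamma> (shape m \<kappa> (0\<^sup>2) (0\<^sup>2) 1) (shape m \<kappa> 1 (1\<^sup>2) 0) \<and>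
      \<gamma> ` {0<..<1} = (\<lambda>w. shape m \<kappa> (w\<^sup>2) ((g1 w)\<^sup>2) 1) ` {0<..}"
  proof (rule smooth_curve_of_plane_curve[OF m \<kappa> _ interval_param_halfline])
    show "((\<lambda>w. shape m \<kappa> (w\<^sup>2) ((g1 w)\<^sup>2) 1) \<longlongrightarrow> shape m \<kappa> (0\<^sup>2) (0\<^sup>2) 1) (at_right 0)"
      by (intro shape_end_finite m g1_0 id_at_right_0)
    show "((\<lambda>w. shape m \<kappa> (w\<^sup>2) ((g1 w)\<^sup>2) 1) \<longlongrightarrow> shape m \<kappa> 1 (1\<^sup>2) 0) at_top"
      by (intro shape_end_x_infinite m filterlim_ident g1_inf)
  qed (use g1 ident in auto)
  have c2: "\<exists>\<gamma>. smooth_curve_with_ends \<gamma> (shape m \<kappa> (0\<^sup>2) (1\<^sup>2) 1) (shape m \<kappa> 0 1 0) \<and>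
      \<gamma> ` {0<..<1} = (\<lambda>w. shape m \<kappa> (w\<^sup>2) ((g2 w)\<^sup>2) 1) ` {0<..<r}"
  proof (rule smooth_curve_of_plane_curve[OF m \<kappa> _ interval_param_segment[OF r(1)]])
    show "((\<lambda>w. shape m \<kappa> (w\<^sup>2) ((g2 w)\<^sup>2) 1) \<longlongrightarrow> shape m \<kappa> (0\<^sup>2) (1\<^sup>2) 1) (at_right 0)"
      by (intro shape_end_finite m g2_0 id_at_right_0)
    show "((\<lambda>w. shape m \<kappa> (w\<^sup>2) ((g2 w)\<^sup>2) 1) \<longlongrightarrow> shape m \<kappa> 0 1 0) (at_left r)"
      by (intro shape_end_y_infinite[OF m tendsto_ident_at] g2_r)
  qed (use g2 ident in auto)
  have c3: "\<exists>\<gamma>. smooth_curve_with_ends \<gamma> (shape m \<kappa> (1\<^sup>2) (0\<^sup>2) 1) (shape m \<kappa> 1 (0\<^sup>2) 0) \<and>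
      \<gamma> ` {0<..<1} = (\<lambda>w. shape m \<kappa> (w\<^sup>2) ((g3 w)\<^sup>2) 1) ` {1<..}"
  proof (rule smooth_curve_of_plane_curve[OF m \<kappa> _ interval_param_halfline])
    show "((\<lambda>w. shape m \<kappa> (w\<^sup>2) ((g3 w)\<^sup>2) 1) \<longlongrightarrow> shape m \<kappa> (1\<^sup>2) (0\<^sup>2) 1) (at_right 1)"
      by (intro shape_end_finite m g3_1 tendsto_ident_at)
    show "((\<lambda>w. shape m \<kappa> (w\<^sup>2) ((g3 w)\<^sup>2) 1) \<longlongrightarrow> shape m \<kappa> 1 (0\<^sup>2) 0) at_top"
      by (intro shape_end_x_infinite m filterlim_ident g3_inf)
  qed (use g3 ident in auto)
  have zeros: "F w z = 0 \<longleftrightarrow> z = g1 w \<or> (w < r \<and> z = g2 w) \<or> (w > 1 \<and> z = g3 w)"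
    if wz: "w > 0" "z > 0" for w z
  proof
    assume root: "F w z = 0"
    consider "F' w z < 0" | "F' w z > 0" | "F' w z = 0" by linarith
    then show "z = g1 w \<or> (w < r \<and> z = g2 w) \<or> (w > 1 \<and> z = g3 w)"
    proof cases
      case 1
      then show ?thesis using g1(3)[of w z] wz root by auto
    next
      case 2
      consider "w < r" | "r \<le> w" "w < 1" | "w = 1" | "w > 1" by linarith
      then show ?thesis
      proof cases
        case 1
        then show ?thesis using g2(3)[of w z] wz root 2 by auto
      next
        case b: 2
        have "F' w z < 0"
          unfolding F'_def using b Lpos_iff[of w] wz root Ppos[of w] Qpos[of w]
          by (intro quintic_deriv_neg_at_root[of "L w" "P w" "Q w"]) (auto simp: F_def)
        then show ?thesis using 2 by simp
      next
        case 3
        then show ?thesis using root root_at_1[of z] wz 2 at_1 order by auto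
      next
        case 4
        then show ?thesis using g3(3)[of w z] wz root 2 by auto
      qed
    next
      case 3
      consider "w < 1" | "w = 1" | "w > 1" by linarith
      then have False
        using 3 sign_below[of w z] sign_above[of w z] root root_at_1[of z] wz at_1 order
        by cases auto
      then show ?thesis ..
    qed
  next
    assume "z = g1 w \<or> (w < r \<and> z = g2 w) \<or> (w > 1 \<and> z = g3 w)"
    then show "F w z = 0" using g1_root(1) g2_root(1) g3_root(1) wz by auto
  qed
  show ?thesis
  proof (rule three_balanced_curvesI[OF m \<kappa> c1 c2 c3])
    show "{#shape m \<kappa> (0\<^sup>2) (0\<^sup>2) 1, shape m \<kappa> 1 (1\<^sup>2) 0, shape m \<kappa> (0\<^sup>2) (1\<^sup>2) 1, shape m \<kappa> 0 1 0,
        shape m \<kappa> (1\<^sup>2) (0\<^sup>2) 1, shape m \<kappa> 1 (0\<^sup>2) 0#} =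
      {#shape m \<kappa> 1 0 0, shape m \<kappa> 0 1 0, shape m \<kappa> 0 0 1,
        shape m \<kappa> 0 1 1, shape m \<kappa> 1 0 1, shape m \<kappa> 1 1 0#}"
      by (simp add: add_mset_commute)
    show "(w > 0 \<and> z > 0 \<and> balance_poly m w z 1 = 0) \<longleftrightarrow>
      (w, z) \<in> (\<lambda>w. (w, g1 w)) ` {0<..} \<union> (\<lambda>w. (w, g2 w)) ` {0<..<r} \<union> (\<lambda>w. (w, g3 w)) ` {1<..}"
      for w z
      using zeros[of w z] g1(2)[of w] g2(2)[of w] g3(2)[of w] by (auto simp: image_graph_iff F)
  qed
qed

text \<open>
  After division by \<open>1 - w\<close>, which accounts for the line \<open>w = 1\<close>, the quintic is of the convex type
  for all \<open>w > 0\<close> and negative at \<open>z = 1\<close> because of \<open>m\<^sub>3 < m\<^sub>2\<close>. So there are always two roots, one on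
  each side of \<open>z = 1\<close>.
\<close>

lemma three_balanced_curves_two_lightest_equal:
  assumes m: "m$1 > 0" "m$2 > 0" "m$3 > 0" and order: "m$1 = m$3" "m$3 < m$2" and \<kappa>: "\<kappa> > 0"
  shows "three_balanced_curves m \<kappa>"
proof -
  define L K Q where
    "L w = (m$2 + m$3) * (1 + w + w\<^sup>2)" and
    "K w = - m$3 * w^3 * (1 + w) - m$2 * (1 + w\<^sup>2) * (1 + w + w\<^sup>2) - m$3 * (1 + w)" and
    "Q w = 2 * m$3 * (1 + w) * w^3" for w
  define F where "F w = quintic (L w) (K w) 0 (Q w)" for w
  define F' where "F' w = quintic_deriv (L w) (K w) 0" for w
  have F: "balance_poly m w z 1 = (1 - w) * F w z" for w z
    unfolding F_def quintic_def balance_poly_def L_def K_def Q_def order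
    by (simp add: algebra_simps power2_eq_square power3_eq_cube eval_nat_numeral)
  have smooth: "C_infinity_on S L" "C_infinity_on S K" "C_infinity_on S (\<lambda>w. 0 :: real)" "C_infinity_on S Q"
    if "open S" for S
    unfolding L_def[abs_def] K_def[abs_def] Q_def[abs_def]
    by (intro C_infinity_intros that)+
  have "F w 1 = - (m$2 - m$3) * (w\<^sup>2 * (1 + w + w\<^sup>2))" for w
    unfolding F_def quintic_def L_def K_def Q_def
    by (simp add: algebra_simps power2_eq_square power3_eq_cube)
  then have F1: "F w 1 < 0" if "w > 0" for w
    using that order by (auto simp: mult_less_0_iff zero_less_mult_iff add_pos_pos)
  have Lpos: "L w > 0" and Qpos: "Q w > 0" if "w > 0" for w
    using that m by (auto simp: L_def Q_def intro!: mult_pos_pos add_pos_pos)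
  have sign: "z \<noteq> 1 \<and> F' w z * (z - 1) > 0" if "w > 0" "z > 0" "F w z = 0" for w z
  proof -
    have "z \<noteq> 1" using F1 that by force
    moreover have "1 * F' w z * (1 - z) < 0"
      unfolding F'_def using that Lpos[of w] Qpos[of w] F1[of w] \<open>z \<noteq> 1\<close>
      by (intro quintic_above_tangent[of 1 "L w" "Q w" 1 z]) (auto simp: F_def)
    ultimately show ?thesis by (simp add: algebra_simps)
  qed
  have same: "u = v" if "w > 0" "u > 0" "v > 0" "F w u = 0" "F w v = 0"
    "\<sigma> * F' w u > 0" "\<sigma> * F' w v > 0" for w u v \<sigma>
    using quintic_root_unique[of 1 "L w" "Q w" u v "K w" 0 \<sigma>] that Lpos[of w] Qpos[of w]
    by (auto simp: F_def F'_def)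
  have between: "\<exists>z. u < z \<and> z < v \<and> F w z = 0" if "u < v" "F w u * F w v < 0" for w u v
    using that root_between[of u v "F w"] continuous_on_quintic unfolding F_def by blast
  have F0: "F w 0 = Q w" for w by (simp add: F_def quintic_def)
  have neg_ex: "\<exists>z>0. F w z = 0 \<and> - 1 * F' w z > 0" if w: "w > 0" for w
  proof -
    obtain z where "0 < z" "z < 1" "F w z = 0"
      using between[of 0 1 w] Qpos[of w] F1[of w] w by (auto simp: F0 mult_less_0_iff)
    then show ?thesis using sign[of w z] w by (auto simp: zero_less_mult_iff)
  qed
  have pos_ex: "\<exists>z>0. F w z = 0 \<and> 1 * F' w z > 0" if w: "w > 0" for w
  proof -
    obtain N where "N > 1" "F w N > 0"
      using quintic_sign_at_infinity[of 1 "L w" 1 "K w" 0 "Q w"] Lpos[OF w] by (auto simp: F_def)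
    then obtain z where "1 < z" "F w z = 0"
      using between[of 1 N w] F1[OF w] by (auto simp: mult_less_0_iff)
    then show ?thesis using sign[of w z] w by (intro exI[of _ z]) (auto simp: zero_less_mult_iff)
  qed
  obtain g1 where g1: "C_infinity_on {0<..} g1" "\<And>w. w \<in> {0<..} \<Longrightarrow> g1 w > 0"
    "\<And>w z. w \<in> {0<..} \<Longrightarrow> z > 0 \<Longrightarrow> z = g1 w \<longleftrightarrow> F w z = 0 \<and> - 1 * F' w z > 0"
    unfolding F_def F'_def
    by (rule smooth_quintic_branch[of "{0<..}" L K "\<lambda>_. 0" Q "-1"])
      (use smooth neg_ex same[of _ _ _ "-1"] in \<open>auto simp: F_def F'_def\<close>)
  obtain g2 where g2: "C_infinity_on {0<..} g2" "\<And>w. w \<in> {0<..} \<Longrightarrow> g2 w > 0"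
    "\<And>w z. w \<in> {0<..} \<Longrightarrow> z > 0 \<Longrightarrow> z = g2 w \<longleftrightarrow> F w z = 0 \<and> 1 * F' w z > 0"
    unfolding F_def F'_def
    by (rule smooth_quintic_branch[of "{0<..}" L K "\<lambda>_. 0" Q 1])
      (use smooth pos_ex same[of _ _ _ 1] in \<open>auto simp: F_def F'_def\<close>)
  have g1_root: "F w (g1 w) = 0" "F' w (g1 w) < 0" if "w > 0" for w
    using g1(3)[of w "g1 w"] g1(2)[of w] that by auto
  have g2_root: "F w (g2 w) = 0" "F' w (g2 w) > 0" if "w > 0" for w
    using g2(3)[of w "g2 w"] g2(2)[of w] that by auto
  have "isCont (\<lambda>w. F w z) a" for z a
    unfolding F_def quintic_def L_def K_def Q_def by (intro continuous_intros)
  then have near: "\<forall>\<^sub>F w in at a within A. s * F w z > 0" if "s * F a z > 0" for s a z A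
    using eventually_sign_near[of a "\<lambda>w. F w z" s A] that by blast
  have F_0: "F 0 z = (m$2 + m$3) * z^3 * (z\<^sup>2 - 1)" for z
    using F[of 0 z] by (simp add: balance_poly_0)
  have right_0: "\<forall>\<^sub>F w in at_right 0. (0::real) < w" by (simp add: eventually_at_right_less)
  have g1_less: "g1 w < 1" if "w > 0" for w
    using sign[of w "g1 w"] g1_root[OF that] g1(2)[of w] that by (auto simp: zero_less_mult_iff)
  have g1_0: "(g1 \<longlongrightarrow> 0) (at_right 0)"
  proof (rule order_tendstoI)
    fix c :: real
    assume "c < 0"
    show "\<forall>\<^sub>F w in at_right 0. c < g1 w"
      using right_0 by eventually_elim (use g1(2) \<open>c < 0\<close> in force)+
  next
    fix c :: real
    assume "0 < c"
    define e where "e = min c (1/2)"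
    have e: "0 < e" "e < 1" "e \<le> c" using \<open>0 < c\<close> by (auto simp: e_def)
    have "- 1 * F 0 e > 0"
      using e m power_strict_mono[of e 1 2] by (auto simp: F_0 mult_less_0_iff)
    then have "\<forall>\<^sub>F w in at_right 0. - 1 * F w e > 0" by (rule near)
    then show "\<forall>\<^sub>F w in at_right 0. g1 w < c"
      using right_0
    proof eventually_elim
      case (elim w)
      then obtain z where z: "0 < z" "z < e" "F w z = 0"
        using between[of 0 e w] e Qpos[of w] by (auto simp: F0 mult_less_0_iff)
      then have "z = g1 w"
        using g1(3)[of w z] sign[of w z] elim e by (auto simp: zero_less_mult_iff)
      then show ?case using z e by simp
    qed
  qed
  have g1_inf: "((\<lambda>w. g1 w / w) \<longlongrightarrow> 0) at_top"
  proof (rule tendsto_sandwich)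
    show "\<forall>\<^sub>F w in at_top. 0 \<le> g1 w / w"
      using eventually_gt_at_top[of 1] by eventually_elim (simp add: g1(2) less_imp_le)
    show "\<forall>\<^sub>F w in at_top. g1 w / w \<le> inverse w"
      using eventually_gt_at_top[of 1]
      by eventually_elim (simp add: g1_less less_imp_le inverse_eq_divide divide_right_mono)
  qed (auto intro: tendsto_inverse_0_at_top filterlim_ident)
  have g2_0: "(g2 \<longlongrightarrow> 1) (at_right 0)"
  proof (rule tendsto_nearby_boundsI[of 0 1 2])
    fix u v :: real
    assume uv: "0 < u" "u < 1" "1 < v" "v < 2"
    have "1 * F 0 v > 0" using uv m power_strict_mono[of 1 v 2] by (auto simp: F_0)
    then have "\<forall>\<^sub>F w in at_right 0. 1 * F w v > 0" by (rule near)
    then show "\<forall>\<^sub>F w in at_right 0. u < g2 w \<and> g2 w < v"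
      using right_0
    proof eventually_elim
      case (elim w)
      then obtain z where z: "1 < z" "z < v" "F w z = 0"
        using between[of 1 v w] uv F1[of w] by (auto simp: mult_less_0_iff)
      then have "z = g2 w"
        using g2(3)[of w z] sign[of w z] elim by (auto simp: zero_less_mult_iff)
      then show ?case using z uv by simp
    qed
  qed simp_all
  have g2_inf: "((\<lambda>w. g2 w / w) \<longlongrightarrow> 1) at_top"
  proof (rule tendsto_nearby_boundsI[of 0 1 2])
    fix u v :: real
    assume uv: "0 < u" "u < 1" "1 < v" "v < 2"
    have u: "1 * balance_poly m 1 u 0 > 0"
      unfolding balance_poly_infinity using uv m power_strict_mono[of u 1 2] by auto
    have v: "- 1 * balance_poly m 1 v 0 > 0"
      unfolding balance_poly_infinity
      using uv m power_strict_mono[of 1 v 2] by (auto simp: mult_less_0_iff)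
    from eventually_sign_at_top[OF u] eventually_sign_at_top[OF v]
    show "\<forall>\<^sub>F w in at_top. u < g2 w / w \<and> g2 w / w < v"
      using eventually_gt_at_top[of "1 / u"]
    proof eventually_elim
      case (elim w)
      have w: "w > 1" "u * w > 1"
      proof -
        show "u * w > 1" using elim(3) uv by (simp add: field_simps)
        have "1 / u > 1" using uv by simp
        then show "w > 1" using elim(3) by linarith
      qed
      then have "F w (u * w) < 0" "F w (v * w) > 0"
        using elim(1,2) by (auto simp: F mult_less_0_iff zero_less_mult_iff)
      then obtain z where z: "u * w < z" "z < v * w" "F w z = 0"
        using between[of "u * w" "v * w" w] uv w by (auto simp: mult_less_0_iff)
      then have "z = g2 w"
        using g2(3)[of w z] sign[of w z] w by (auto simp: zero_less_mult_iff)
      then show ?case using z w by (simp add: field_simps)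
    qed
  qed simp_all
  have c1: "\<exists>\<gamma>. smooth_curve_with_ends \<gamma> (shape m \<kappa> (1\<^sup>2) (0\<^sup>2) 1) (shape m \<kappa> 0 1 0) \<and>
      \<gamma> ` {0<..<1} = (\<lambda>w. shape m \<kappa> (1\<^sup>2) (w\<^sup>2) 1) ` {0<..}"
  proof (rule smooth_curve_of_plane_curve[OF m \<kappa> _ interval_param_halfline])
    show "((\<lambda>w. shape m \<kappa> (1\<^sup>2) (w\<^sup>2) 1) \<longlongrightarrow> shape m \<kappa> (1\<^sup>2) (0\<^sup>2) 1) (at_right 0)"
      by (intro shape_end_finite m id_at_right_0 tendsto_const)
    show "((\<lambda>w. shape m \<kappa> (1\<^sup>2) (w\<^sup>2) 1) \<longlongrightarrow> shape m \<kappa> 0 1 0) at_top"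
      by (intro shape_end_y_infinite[OF m tendsto_const] filterlim_ident)
  qed (auto intro: C_infinity_ident_pos C_infinity_one_pos)
  have c2: "\<exists>\<gamma>. smooth_curve_with_ends \<gamma> (shape m \<kappa> (0\<^sup>2) (0\<^sup>2) 1) (shape m \<kappa> 1 (0\<^sup>2) 0) \<and>
      \<gamma> ` {0<..<1} = (\<lambda>w. shape m \<kappa> (w\<^sup>2) ((g1 w)\<^sup>2) 1) ` {0<..}"
  proof (rule smooth_curve_of_plane_curve[OF m \<kappa> _ interval_param_halfline])
    show "((\<lambda>w. shape m \<kappa> (w\<^sup>2) ((g1 w)\<^sup>2) 1) \<longlongrightarrow> shape m \<kappa> (0\<^sup>2) (0\<^sup>2) 1) (at_right 0)"
      by (intro shape_end_finite m g1_0 id_at_right_0)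
    show "((\<lambda>w. shape m \<kappa> (w\<^sup>2) ((g1 w)\<^sup>2) 1) \<longlongrightarrow> shape m \<kappa> 1 (0\<^sup>2) 0) at_top"
      by (intro shape_end_x_infinite m filterlim_ident g1_inf)
  qed (use g1 C_infinity_ident_pos in auto)
  have c3: "\<exists>\<gamma>. smooth_curve_with_ends \<gamma> (shape m \<kappa> (0\<^sup>2) (1\<^sup>2) 1) (shape m \<kappa> 1 (1\<^sup>2) 0) \<and>
      \<gamma> ` {0<..<1} = (\<lambda>w. shape m \<kappa> (w\<^sup>2) ((g2 w)\<^sup>2) 1) ` {0<..}"
  proof (rule smooth_curve_of_plane_curve[OF m \<kappa> _ interval_param_halfline])
    show "((\<lambda>w. shape m \<kappa> (w\<^sup>2) ((g2 w)\<^sup>2) 1) \<longlongrightarrow> shape m \<kappa> (0\<^sup>2) (1\<^sup>2) 1) (at_right 0)"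
      by (intro shape_end_finite m g2_0 id_at_right_0)
    show "((\<lambda>w. shape m \<kappa> (w\<^sup>2) ((g2 w)\<^sup>2) 1) \<longlongrightarrow> shape m \<kappa> 1 (1\<^sup>2) 0) at_top"
      by (intro shape_end_x_infinite m filterlim_ident g2_inf)
  qed (use g2 C_infinity_ident_pos in auto)
  have zeros: "F w z = 0 \<longleftrightarrow> z = g1 w \<or> z = g2 w" if "w > 0" "z > 0" for w z
    using sign[of w z] g1(3)[of w z] g2(3)[of w z] g1_root[of w] g2_root[of w] that
    by (auto simp: zero_less_mult_iff)
  show ?thesis
  proof (rule three_balanced_curvesI[OF m \<kappa> c1 c2 c3])
    show "{#shape m \<kappa> (1\<^sup>2) (0\<^sup>2) 1, shape m \<kappa> 0 1 0, shape m \<kappa> (0\<^sup>2) (0\<^sup>2) 1, shape m \<kappa> 1 (0\<^sup>2) 0,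
        shape m \<kappa> (0\<^sup>2) (1\<^sup>2) 1, shape m \<kappa> 1 (1\<^sup>2) 0#} =
      {#shape m \<kappa> 1 0 0, shape m \<kappa> 0 1 0, shape m \<kappa> 0 0 1,
        shape m \<kappa> 0 1 1, shape m \<kappa> 1 0 1, shape m \<kappa> 1 1 0#}"
      by (simp add: add_mset_commute)
    show "(w > 0 \<and> z > 0 \<and> balance_poly m w z 1 = 0) \<longleftrightarrow>
      (w, z) \<in> (\<lambda>w. (1, w)) ` {0<..} \<union> (\<lambda>w. (w, g1 w)) ` {0<..} \<union> (\<lambda>w. (w, g2 w)) ` {0<..}"
      for w z
      using zeros[of w z] g1(2)[of w] g2(2)[of w] by (auto simp: image_graph_iff F)
  qed
qed

section \<open>Arbitrary masses\<close>

lemma three_balanced_curves_sorted: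
  assumes m: "m$1 > 0" "m$2 > 0" "m$3 > 0" and order: "m$1 \<ge> m$2" "m$2 \<ge> m$3" and \<kappa>: "\<kappa> > 0"
  shows "three_balanced_curves m \<kappa>"
proof -
  consider "m$2 > m$3" | "m$2 = m$3" "m$1 > m$2" | "m$2 = m$1" "m$3 = m$1"
    using order by linarith
  then show ?thesis
  proof cases
    case 1
    then show ?thesis using three_balanced_curves_lightest_unique m order \<kappa> by blast
  next
    case 2
    then have "three_balanced_curves (swap12 m) \<kappa>"
      using m \<kappa> by (intro three_balanced_curves_two_lightest_equal) (simp_all add: swap_nth)
    then show ?thesis by (rule three_balanced_curves_swap12)
  next
    case 3
    then show ?thesis using three_balanced_curves_equal_masses m \<kappa> by blast
  qed
qed

theorem theorem4:
  fixes m :: "real^3" and \<kappa> :: real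
  assumes "m$1 > 0" and "m$2 > 0" and "m$3 > 0" and "\<kappa> > 0"
  shows "\<exists>\<gamma>\<^sub>1 \<gamma>\<^sub>2 \<gamma>\<^sub>3 P\<^sub>1 Q\<^sub>1 P\<^sub>2 Q\<^sub>2 P\<^sub>3 Q\<^sub>3.
    smooth_curve_with_ends \<gamma>\<^sub>1 P\<^sub>1 Q\<^sub>1 \<and>
    smooth_curve_with_ends \<gamma>\<^sub>2 P\<^sub>2 Q\<^sub>2 \<and>
    smooth_curve_with_ends \<gamma>\<^sub>3 P\<^sub>3 Q\<^sub>3 \<and>
    {#P\<^sub>1, Q\<^sub>1, P\<^sub>2, Q\<^sub>2, P\<^sub>3, Q\<^sub>3#} =
      {#shape m \<kappa> 1 0 0, shape m \<kappa> 0 1 0, shape m \<kappa> 0 0 1,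
        shape m \<kappa> 0 1 1, shape m \<kappa> 1 0 1, shape m \<kappa> 1 1 0#} \<and>
    balanced_configurations m \<kappa> =
      \<gamma>\<^sub>1 ` {0<..<1} \<union> \<gamma>\<^sub>2 ` {0<..<1} \<union> \<gamma>\<^sub>3 ` {0<..<1}"
proof -
  \<comment> \<open>Sorting the masses by exchanges of neighbours.\<close>
  have top: "three_balanced_curves p \<kappa>"
    if "p$1 > 0" "p$2 > 0" "p$3 > 0" "p$1 \<ge> p$2" "p$1 \<ge> p$3" for p
    using that three_balanced_curves_sorted[of p \<kappa>] three_balanced_curves_sorted[of "swap23 p" \<kappa>]
      three_balanced_curves_swap23[of p \<kappa>] assms(4) linear[of "p$2" "p$3"] by (auto simp: swap_nth)
  have two: "three_balanced_curves p \<kappa>"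
    if "p$1 > 0" "p$2 > 0" "p$3 > 0" "p$1 \<ge> p$3 \<or> p$2 \<ge> p$3" for p
    using that top[of p] top[of "swap12 p"] three_balanced_curves_swap12[of p \<kappa>]
      linear[of "p$1" "p$2"] order_trans[of "p$3" "p$1" "p$2"] order_trans[of "p$3" "p$2" "p$1"]
    by (auto simp: swap_nth)
  have "three_balanced_curves m \<kappa>"
    using assms two[of m] two[of "swap23 m"] three_balanced_curves_swap23[of m \<kappa>]
      linear[of "m$2" "m$3"]
    by (auto simp: swap_nth)
  then show ?thesis unfolding three_balanced_curves_def .
qed

end
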